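(* Given an $\alpha$-approximation algorithm for CorrKO with respect to the non-adaptive optimum (i.e., an algorithm whose output policy has expected reward at least $1/\alpha$ times the maximum expected reward achievable by a non-adaptive policy), one can obtain an $O(\alpha)$-approximation algorithm for orienteering with knapsack deadlines (OrientKD).
   Context: CorrKO: a finite metric $(V,d)$ with integer distances, root $\rho$, travel budget $B$, processing budget $W$; each vertex $v$ has random integer size $S_v\ge0$ and correlated random reward $R_v\ge0$, independent across vertices; a policy starts at $\rho$ and visits distinct vertices, processing jobs non-preemptively with $(S_v,R_v)$ revealed on completion; if it visits $\rho=v_0,\dots,v_\ell$ then $\sum_{i}d(v_{i-1},v_i)\le B$ and $\sum_{i=1}^{\ell-1}S_{v_i}\le W$, and the reward of $v_i$ is collected iff $\sum_{h\le i}S_{v_h}\le W$. A non-adaptive policy fixes its vertex sequence in advance. OrientKD (rooted): metric $(V,d)$, root $\rho$, budget $B$, rewards $\pi_v\ge0$, knapsack weights $\mathrm{wt}_v\ge0$ and knapsack deadlines $\mathrm{KD}_v$; a path $P$ starting at $\rho$ is feasible if $d(P)\le B$ and $\sum_{u\in P_{\rho,v}}\mathrm{wt}_u\le \mathrm{KD}_v$ for every $v\in P$ ($P_{\rho,v}$ the $\rho$-$v$ portion of $P$); maximize $\sum_{v\in P}\pi_v$. *)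

theory Defs
  imports "HOL-Probability.Probability" "HOL-Library.Log_Nat"
begin

section \<open>Polynomial time\<close>

text \<open>
  No machine model is available in the imported libraries, so polynomial-time computability is
  defined through a small deterministic programming language over binary trees with integer leaves.
  Every basic operation is charged the bit size of its input plus the bit size of its output
  (logarithmic cost), so that running times agree with Turing machine times up to a polynomial.
\<close>

datatype val = Num int | Node val val

fun vsize :: "val \<Rightarrow> nat" where
  "vsize (Num i) = 1 + nat (bitlen \<bar>i\<bar>)"
| "vsize (Node x y) = 1 + vsize x + vsize y"

datatype prim = Ident | Const val | Fst | Snd | IsNode | Leq | Add | Sub | Mul | Div

text \<open>Ill-typed arguments yield \<open>Num 0\<close>.\<close>

fun prim_val :: "prim \<Rightarrow> val \<Rightarrow> val" where
  "prim_val Ident x = x"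
| "prim_val (Const c) x = c"
| "prim_val Fst (Node x y) = x"
| "prim_val Snd (Node x y) = y"
| "prim_val IsNode (Node x y) = Num 1"
| "prim_val Leq (Node (Num a) (Num b)) = Num (if a \<le> b then 1 else 0)"
| "prim_val Add (Node (Num a) (Num b)) = Num (a + b)"
| "prim_val Sub (Node (Num a) (Num b)) = Num (a - b)"
| "prim_val Mul (Node (Num a) (Num b)) = Num (a * b)"
| "prim_val Div (Node (Num a) (Num b)) = Num (a div b)"
| "prim_val _ _ = Num 0"

datatype prog = Prim prim | Seq prog prog | Fork prog prog | Cond prog prog prog | While prog prog

text \<open>\<open>exec p x y t\<close>: on input \<open>x\<close> the program \<open>p\<close> halts with output \<open>y\<close> after time \<open>t\<close>.
  A test succeeds iff its value differs from \<open>Num 0\<close>.\<close>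

inductive exec :: "prog \<Rightarrow> val \<Rightarrow> val \<Rightarrow> nat \<Rightarrow> bool" where
  exec_Prim: "exec (Prim f) x (prim_val f x) (1 + vsize x + vsize (prim_val f x))"
| exec_Seq: "exec p x y s \<Longrightarrow> exec q y z t \<Longrightarrow> exec (Seq p q) x z (s + t)"
| exec_Fork: "exec p x y s \<Longrightarrow> exec q x z t \<Longrightarrow> exec (Fork p q) x (Node y z) (1 + s + t)"
| exec_CondT: "exec b x v s \<Longrightarrow> v \<noteq> Num 0 \<Longrightarrow> exec p x y t \<Longrightarrow> exec (Cond b p q) x y (s + t)"
| exec_CondF: "exec b x (Num 0) s \<Longrightarrow> exec q x y t \<Longrightarrow> exec (Cond b p q) x y (s + t)"
| exec_WhileF: "exec b x (Num 0) s \<Longrightarrow> exec (While b p) x x s"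
| exec_WhileT: "exec b x v s \<Longrightarrow> v \<noteq> Num 0 \<Longrightarrow> exec p x y t \<Longrightarrow> exec (While b p) y z u
    \<Longrightarrow> exec (While b p) x z (s + t + u)"

definition poly_time :: "('a \<Rightarrow> val) \<Rightarrow> ('b \<Rightarrow> val) \<Rightarrow> 'a set \<Rightarrow> ('a \<Rightarrow> 'b) \<Rightarrow> bool" where
  "poly_time enc_in enc_out D f \<longleftrightarrow>
     (\<exists>p c k. \<forall>x\<in>D. \<exists>t. exec p (enc_in x) (enc_out (f x)) t \<and> t \<le> c * vsize (enc_in x) ^ k)"

fun enc_list :: "('a \<Rightarrow> val) \<Rightarrow> 'a list \<Rightarrow> val" where
  "enc_list e [] = Num 0"
| "enc_list e (x # xs) = Node (e x) (enc_list e xs)"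

definition enc_nat :: "nat \<Rightarrow> val" where
  "enc_nat m = Num (int m)"

definition enc_rat :: "rat \<Rightarrow> val" where
  "enc_rat q = Node (Num (fst (quotient_of q))) (Num (snd (quotient_of q)))"

fun enc_option :: "nat option \<Rightarrow> val" where
  "enc_option None = Num (- 1)"
| "enc_option (Some m) = Num (int m)"


section \<open>Paths\<close>

definition path_length :: "(nat \<Rightarrow> nat \<Rightarrow> 'a::comm_monoid_add) \<Rightarrow> nat list \<Rightarrow> 'a" where
  "path_length d P = (\<Sum>i<length P - 1. d (P ! i) (P ! Suc i))"


section \<open>Correlated knapsack orienteering\<close>

text \<open>
  Vertices are \<open>0, \<dots>, nv - 1\<close>.  The joint distribution of size and reward of a vertex is
  listed explicitly as pairs \<open>((size, reward), probability)\<close>.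
\<close>

record corrko =
  nv :: nat
  root :: nat
  dst :: "nat \<Rightarrow> nat \<Rightarrow> nat"
  travel_budget :: nat
  proc_budget :: nat
  jobs :: "nat \<Rightarrow> ((nat \<times> rat) \<times> rat) list"

definition job_list :: "corrko \<Rightarrow> nat \<Rightarrow> ((nat \<times> rat) \<times> real) list" where
  "job_list I v = map (\<lambda>(x, q). (x, real_of_rat q)) (jobs I v)"

definition job_pmf :: "corrko \<Rightarrow> nat \<Rightarrow> (nat \<times> rat) pmf" where
  "job_pmf I v = pmf_of_list (job_list I v)"

text \<open>The root carries no job, i.e. it has size and reward 0.\<close>

definition corrko_instance :: "corrko \<Rightarrow> bool" where
  "corrko_instance I \<longleftrightarrow>
     root I < nv I \<and>
     Metric_space {..<nv I} (\<lambda>u v. real (dst I u v)) \<and>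
     (\<forall>v<nv I. pmf_of_list_wf (job_list I v) \<and> (\<forall>((s, r), q)\<in>set (jobs I v). r \<ge> 0)) \<and>
     job_pmf I (root I) = return_pmf (0, 0)"

text \<open>An outcome fixes \<open>(size, reward)\<close> of every vertex; different vertices are independent.\<close>

definition outcomes :: "corrko \<Rightarrow> (nat \<Rightarrow> nat \<times> rat) pmf" where
  "outcomes I = Pi_pmf {..<nv I} (0, 0) (job_pmf I)"

text \<open>
  A history lists the non-root vertices whose jobs have been processed, in order of processing,
  together with the revealed size and reward.  A policy maps the history to the vertex to visit
  next, or to \<open>None\<close> to stop.
\<close>

type_synonym history = "(nat \<times> nat \<times> rat) list"
type_synonym policy = "history \<Rightarrow> nat option"

definition used :: "history \<Rightarrow> nat" where
  "used h = (\<Sum>(v, s, r)\<leftarrow>h. s)"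

text \<open>No further vertex is visited once the processing budget is exceeded.\<close>

definition policy_step :: "corrko \<Rightarrow> policy \<Rightarrow> (nat \<Rightarrow> nat \<times> rat) \<Rightarrow> history \<Rightarrow> history" where
  "policy_step I pol \<omega> h =
     (if used h \<le> proc_budget I
      then (case pol h of None \<Rightarrow> h | Some v \<Rightarrow> h @ [(v, \<omega> v)])
      else h)"

text \<open>
  The run of a feasible policy visits distinct vertices and is thus over after \<open>nv I\<close> steps; a
  policy that visits a vertex in each of the \<open>nv I\<close> steps repeats a vertex and is not feasible.
\<close>

definition run :: "corrko \<Rightarrow> policy \<Rightarrow> (nat \<Rightarrow> nat \<times> rat) \<Rightarrow> history" where
  "run I pol \<omega> = (policy_step I pol \<omega> ^^ nv I) []"

definition visited :: "corrko \<Rightarrow> history \<Rightarrow> nat list" where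
  "visited I h = root I # map fst h"

definition feasible_policy :: "corrko \<Rightarrow> policy \<Rightarrow> bool" where
  "feasible_policy I pol \<longleftrightarrow>
     (\<forall>\<omega>\<in>set_pmf (outcomes I). let P = visited I (run I pol \<omega>) in
        distinct P \<and> set P \<subseteq> {..<nv I} \<and> path_length (dst I) P \<le> travel_budget I)"

definition collected :: "corrko \<Rightarrow> history \<Rightarrow> rat" where
  "collected I h =
     (\<Sum>i<length h. if used (take (Suc i) h) \<le> proc_budget I then snd (snd (h ! i)) else 0)"

definition expected_reward :: "corrko \<Rightarrow> policy \<Rightarrow> real" where
  "expected_reward I pol =
     measure_pmf.expectation (outcomes I) (\<lambda>\<omega>. real_of_rat (collected I (run I pol \<omega>)))"

definition nonadaptive :: "nat list \<Rightarrow> policy" where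
  "nonadaptive vs h = (if length h < length vs then Some (vs ! length h) else None)"

definition enc_corrko :: "corrko \<Rightarrow> val" where
  "enc_corrko I = enc_list id
     [enc_nat (nv I), enc_nat (root I),
      enc_list (enc_list enc_nat) (map (\<lambda>u. map (dst I u) [0..<nv I]) [0..<nv I]),
      enc_nat (travel_budget I), enc_nat (proc_budget I),
      enc_list (enc_list (\<lambda>((s, r), q). Node (Node (enc_nat s) (enc_rat r)) (enc_rat q)))
        (map (jobs I) [0..<nv I])]"

definition enc_history :: "history \<Rightarrow> val" where
  "enc_history = enc_list (\<lambda>(v, s, r). Node (enc_nat v) (Node (enc_nat s) (enc_rat r)))"

definition histories :: "corrko \<Rightarrow> history set" where
  "histories I = {h. distinct (visited I h) \<and>
     (\<forall>(v, x)\<in>set h. v < nv I \<and> x \<in> set_pmf (job_pmf I v))}"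

text \<open>
  A policy may be adaptive, hence too large to be written out as a decision tree.  The algorithm
  \<open>A\<close> therefore outputs a description of a policy, and \<open>Q\<close> executes a described policy:
  it computes the next decision from the description and the history.  The performance of the
  policy is measured against the non-adaptive optimum.
\<close>

definition corrko_approx_nonadaptive ::
    "(nat \<Rightarrow> real) \<Rightarrow> (corrko \<Rightarrow> val) \<Rightarrow> (val \<times> history \<Rightarrow> nat option) \<Rightarrow> bool" where
  "corrko_approx_nonadaptive \<alpha> A Q \<longleftrightarrow>
     poly_time enc_corrko id {I. corrko_instance I} A \<and>
     poly_time (\<lambda>(z, h). Node z (enc_history h)) enc_option
       {(A I, h) | I h. corrko_instance I \<and> h \<in> histories I} Q \<and>
     (\<forall>I. corrko_instance I \<longrightarrow>
        (let pol = (\<lambda>h. Q (A I, h)) in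
           feasible_policy I pol \<and>
           (\<forall>vs. feasible_policy I (nonadaptive vs) \<longrightarrow>
              expected_reward I pol \<ge> 1 / \<alpha> (nv I) * expected_reward I (nonadaptive vs))))"


section \<open>Orienteering with knapsack deadlines\<close>

record orientkd =
  knv :: nat
  kroot :: nat
  kdst :: "nat \<Rightarrow> nat \<Rightarrow> rat"
  kbudget :: rat
  kreward :: "nat \<Rightarrow> rat"
  kweight :: "nat \<Rightarrow> rat"
  kdeadline :: "nat \<Rightarrow> rat"

definition orientkd_instance :: "orientkd \<Rightarrow> bool" where
  "orientkd_instance J \<longleftrightarrow>
     kroot J < knv J \<and>
     Metric_space {..<knv J} (\<lambda>u v. real_of_rat (kdst J u v)) \<and>
     kbudget J \<ge> 0 \<and>
     (\<forall>v<knv J. kreward J v \<ge> 0 \<and> kweight J v \<ge> 0)"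

definition orientkd_feasible :: "orientkd \<Rightarrow> nat list \<Rightarrow> bool" where
  "orientkd_feasible J P \<longleftrightarrow>
     P \<noteq> [] \<and> hd P = kroot J \<and> distinct P \<and> set P \<subseteq> {..<knv J} \<and>
     path_length (kdst J) P \<le> kbudget J \<and>
     (\<forall>i<length P. (\<Sum>j\<le>i. kweight J (P ! j)) \<le> kdeadline J (P ! i))"

definition orientkd_value :: "orientkd \<Rightarrow> nat list \<Rightarrow> rat" where
  "orientkd_value J P = (\<Sum>v\<in>set P. kreward J v)"

definition enc_orientkd :: "orientkd \<Rightarrow> val" where
  "enc_orientkd J = enc_list id
     [enc_nat (knv J), enc_nat (kroot J),
      enc_list (enc_list enc_rat) (map (\<lambda>u. map (kdst J u) [0..<knv J]) [0..<knv J]),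
      enc_rat (kbudget J),
      enc_list enc_rat (map (kreward J) [0..<knv J]),
      enc_list enc_rat (map (kweight J) [0..<knv J]),
      enc_list enc_rat (map (kdeadline J) [0..<knv J])]"

text \<open>If the root violates its own deadline, no feasible path exists and nothing is required of
  the output.\<close>

definition orientkd_approx :: "(nat \<Rightarrow> real) \<Rightarrow> (orientkd \<Rightarrow> nat list) \<Rightarrow> bool" where
  "orientkd_approx \<alpha> alg \<longleftrightarrow>
     poly_time enc_orientkd (enc_list enc_nat) {J. orientkd_instance J} alg \<and>
     (\<forall>J. orientkd_instance J \<and> (\<exists>P. orientkd_feasible J P) \<longrightarrow>
        orientkd_feasible J (alg J) \<and>
        (\<forall>P. orientkd_feasible J P \<longrightarrow>
           real_of_rat (orientkd_value J (alg J)) \<ge>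
             1 / \<alpha> (knv J) * real_of_rat (orientkd_value J P)))"

end

(*
  A vertex v of the OrientKD instance becomes a job that has size wt_v and no reward with
  probability 1 - 1/(2n), and size W - KD_v + wt_v and reward pi_v with probability 1/(2n),
  where W exceeds twice the total weight.  A large job is paid for iff the small jobs before it,
  together with wt_v, respect KD_v, and two large jobs never fit into W.  So along a path that is
  feasible for OrientKD each vertex is rewarded with probability at least 1/(4n).  Conversely,
  before its first large job even an adaptive policy follows the single path that it takes when
  all jobs are small, hence it earns at most 1/(2n) times the value of the vertices on that path
  that meet their deadlines.  Shortcutting that path to these vertices (and the root) keeps it
  feasible and loses only the factor 2 between the two probabilities.  The path is found by
  simulating the policy on the all-small outcome; rational data are scaled to integers by the
  product of all denominators, whose bit size is linear in the input.
*)

theory Submission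
  imports Defs
begin

section \<open>Polynomial bounds\<close>

definition poly_bounded :: "('a \<Rightarrow> val) \<Rightarrow> 'a set \<Rightarrow> ('a \<Rightarrow> nat) \<Rightarrow> bool" where
  "poly_bounded e D s \<longleftrightarrow> (\<exists>c k. \<forall>x\<in>D. s x \<le> c * vsize (e x) ^ k)"

lemma vsize_pos [simp]: "0 < vsize x"
  by (cases x) auto

lemma one_le_vsize [simp]: "Suc 0 \<le> vsize x"
  using vsize_pos[of x] by linarith

lemma poly_bounded_mono:
  assumes "poly_bounded e D s" "\<And>x. x \<in> D \<Longrightarrow> s' x \<le> s x"
  shows "poly_bounded e D s'"
  using assms unfolding poly_bounded_def by (meson order_trans)

lemma poly_bounded_subset: "poly_bounded e D s \<Longrightarrow> D' \<subseteq> D \<Longrightarrow> poly_bounded e D' s"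
  unfolding poly_bounded_def by (meson subsetD)

lemma poly_bounded_const: "poly_bounded e D (\<lambda>_. c)"
  unfolding poly_bounded_def by (rule exI[of _ c], rule exI[of _ 0]) auto

lemma poly_bounded_vsize: "poly_bounded e D (\<lambda>x. vsize (e x))"
  unfolding poly_bounded_def by (rule exI[of _ 1], rule exI[of _ 1]) auto

lemma poly_bounded_add:
  assumes "poly_bounded e D s" "poly_bounded e D t"
  shows "poly_bounded e D (\<lambda>x. s x + t x)"
proof -
  obtain c k where s: "\<And>x. x \<in> D \<Longrightarrow> s x \<le> c * vsize (e x) ^ k"
    using assms(1) unfolding poly_bounded_def by blast
  obtain c' k' where t: "\<And>x. x \<in> D \<Longrightarrow> t x \<le> c' * vsize (e x) ^ k'"
    using assms(2) unfolding poly_bounded_def by blast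
  have "s x + t x \<le> (c + c') * vsize (e x) ^ (k + k')" if "x \<in> D" for x
  proof -
    have "vsize (e x) ^ k \<le> vsize (e x) ^ (k + k')" "vsize (e x) ^ k' \<le> vsize (e x) ^ (k + k')"
      by (auto intro!: power_increasing)
    then have "c * vsize (e x) ^ k + c' * vsize (e x) ^ k'
        \<le> c * vsize (e x) ^ (k + k') + c' * vsize (e x) ^ (k + k')"
      by (intro add_mono mult_le_mono2)
    with s[OF that] t[OF that] show ?thesis
      unfolding distrib_right by linarith
  qed
  then show ?thesis unfolding poly_bounded_def by blast
qed

lemma poly_bounded_mult:
  assumes "poly_bounded e D s" "poly_bounded e D t"
  shows "poly_bounded e D (\<lambda>x. s x * t x)"
proof -
  obtain c k where s: "\<And>x. x \<in> D \<Longrightarrow> s x \<le> c * vsize (e x) ^ k"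
    using assms(1) unfolding poly_bounded_def by blast
  obtain c' k' where t: "\<And>x. x \<in> D \<Longrightarrow> t x \<le> c' * vsize (e x) ^ k'"
    using assms(2) unfolding poly_bounded_def by blast
  have "s x * t x \<le> (c * c') * vsize (e x) ^ (k + k')" if "x \<in> D" for x
    using mult_le_mono[OF s[OF that] t[OF that]] by (simp add: power_add mult_ac)
  then show ?thesis unfolding poly_bounded_def by blast
qed

lemma poly_bounded_power: "poly_bounded e D s \<Longrightarrow> poly_bounded e D (\<lambda>x. s x ^ k)"
  by (induction k) (auto intro: poly_bounded_const poly_bounded_mult)

lemma poly_bounded_comp:
  assumes "poly_bounded e' E s" "poly_bounded e D (\<lambda>x. vsize (e' (f x)))" "\<And>x. x \<in> D \<Longrightarrow> f x \<in> E"
  shows "poly_bounded e D (\<lambda>x. s (f x))"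
proof -
  obtain c k where "\<And>x. x \<in> E \<Longrightarrow> s x \<le> c * vsize (e' x) ^ k"
    using assms(1) unfolding poly_bounded_def by blast
  then show ?thesis
    using assms(3)
    by (intro poly_bounded_mono[OF poly_bounded_mult[OF poly_bounded_const[of _ _ c]
          poly_bounded_power[OF assms(2), of k]]]) auto
qed

lemmas poly_bounded_intros =
  poly_bounded_add poly_bounded_mult poly_bounded_const poly_bounded_vsize poly_bounded_power


section \<open>Polynomial-time combinators\<close>

lemma exec_vsize: "exec p x y t \<Longrightarrow> vsize x \<le> t \<and> vsize y \<le> t"
  by (induction rule: exec.induct) auto

lemma poly_timeI:
  assumes "\<And>x. x \<in> D \<Longrightarrow> \<exists>t. exec p (e x) (e' (f x)) t \<and> t \<le> T x" "poly_bounded e D T"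
  shows "poly_time e e' D f"
proof -
  obtain c k where "\<And>x. x \<in> D \<Longrightarrow> T x \<le> c * vsize (e x) ^ k"
    using assms(2) unfolding poly_bounded_def by blast
  then show ?thesis using assms(1) unfolding poly_time_def by (meson order_trans)
qed

lemma poly_timeE:
  assumes "poly_time e e' D f"
  obtains p T where "\<And>x. x \<in> D \<Longrightarrow> exec p (e x) (e' (f x)) (T x)" "poly_bounded e D T"
    "\<And>x. x \<in> D \<Longrightarrow> vsize (e' (f x)) \<le> T x"
proof -
  obtain p c k where *: "\<forall>x\<in>D. \<exists>t. exec p (e x) (e' (f x)) t \<and> t \<le> c * vsize (e x) ^ k"
    using assms unfolding poly_time_def by blast
  then obtain T where T: "\<And>x. x \<in> D \<Longrightarrow> exec p (e x) (e' (f x)) (T x) \<and> T x \<le> c * vsize (e x) ^ k"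
    by metis
  show ?thesis
  proof (rule that)
    show "poly_bounded e D T" using T unfolding poly_bounded_def by blast
    show "exec p (e x) (e' (f x)) (T x)" if "x \<in> D" for x using T[OF that] by blast
    then show "vsize (e' (f x)) \<le> T x" if "x \<in> D" for x using exec_vsize that by blast
  qed
qed

lemma poly_time_size:
  "poly_time e e' D f \<Longrightarrow> poly_bounded e D (\<lambda>x. vsize (e' (f x)))"
  by (elim poly_timeE) (rule poly_bounded_mono)

lemma poly_time_cong:
  assumes "poly_time e e' D f" "\<And>x. x \<in> D' \<Longrightarrow> x \<in> D \<and> e'' (g x) = e' (f x)"
  shows "poly_time e e'' D' g"
proof (rule poly_timeE[OF assms(1)])
  fix p T
  assume p: "\<And>x. x \<in> D \<Longrightarrow> exec p (e x) (e' (f x)) (T x)" and T: "poly_bounded e D T"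
  have "D' \<subseteq> D" using assms(2) by blast
  then have "poly_bounded e D' T" using poly_bounded_subset[OF T] by blast
  moreover have "exec p (e x) (e'' (g x)) (T x)" if "x \<in> D'" for x
    using p[of x] assms(2)[OF that] by simp
  ultimately show ?thesis by (intro poly_timeI[of _ p _ _ _ T]) blast+
qed

lemma poly_time_subset: "poly_time e e' D f \<Longrightarrow> D' \<subseteq> D \<Longrightarrow> poly_time e e' D' f"
  by (erule poly_time_cong) auto

lemma poly_time_prim:
  assumes "\<And>x. x \<in> D \<Longrightarrow> prim_val g (e x) = e' (f x)" "poly_bounded e D (\<lambda>x. vsize (e' (f x)))"
  shows "poly_time e e' D f"
proof (rule poly_timeI[of _ "Prim g"])
  fix x assume "x \<in> D"
  then show "\<exists>t. exec (Prim g) (e x) (e' (f x)) t \<and> t \<le> 1 + vsize (e x) + vsize (e' (f x))"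
    using exec_Prim[of g "e x"] assms(1) by (intro exI conjI) auto
qed (intro poly_bounded_intros assms(2))

lemma poly_time_id: "poly_time e e D (\<lambda>x. x)"
  by (rule poly_time_prim[of _ Ident]) (auto intro: poly_bounded_intros)

lemma poly_time_const: "poly_time e e' D (\<lambda>_. c)"
  by (rule poly_time_prim[of _ "Const (e' c)"]) (auto intro: poly_bounded_intros)

lemma poly_time_comp:
  assumes "poly_time e' e'' E g" "poly_time e e' D f" "\<And>x. x \<in> D \<Longrightarrow> f x \<in> E"
  shows "poly_time e e'' D (\<lambda>x. g (f x))"
proof (rule poly_timeE[OF assms(1)], rule poly_timeE[OF assms(2)])
  fix p S q T
  assume *: "\<And>x. x \<in> E \<Longrightarrow> exec p (e' x) (e'' (g x)) (S x)" "poly_bounded e' E S"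
    "\<And>x. x \<in> D \<Longrightarrow> exec q (e x) (e' (f x)) (T x)" "poly_bounded e D T"
  show ?thesis
  proof (rule poly_timeI[of _ "Seq q p"])
    show "poly_bounded e D (\<lambda>x. T x + S (f x))"
      using * assms(3) by (intro poly_bounded_add poly_bounded_comp[OF *(2)] poly_time_size[OF assms(2)])
    show "\<exists>t. exec (Seq q p) (e x) (e'' (g (f x))) t \<and> t \<le> T x + S (f x)" if "x \<in> D" for x
      using * assms(3) that by (intro exI[of _ "T x + S (f x)"]) (auto intro: exec_Seq)
  qed
qed

definition enc_pair :: "('a \<Rightarrow> val) \<Rightarrow> ('b \<Rightarrow> val) \<Rightarrow> 'a \<times> 'b \<Rightarrow> val" where
  "enc_pair e e' = (\<lambda>(x, y). Node (e x) (e' y))"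

lemma enc_pair_simp [simp]: "enc_pair e e' (x, y) = Node (e x) (e' y)"
  by (simp add: enc_pair_def)

lemma poly_time_pair:
  assumes "poly_time e e1 D f" "poly_time e e2 D g"
  shows "poly_time e (enc_pair e1 e2) D (\<lambda>x. (f x, g x))"
proof (rule poly_timeE[OF assms(1)], rule poly_timeE[OF assms(2)])
  fix p S q T
  assume *: "\<And>x. x \<in> D \<Longrightarrow> exec p (e x) (e1 (f x)) (S x)" "poly_bounded e D S"
    "\<And>x. x \<in> D \<Longrightarrow> exec q (e x) (e2 (g x)) (T x)" "poly_bounded e D T"
  show ?thesis
  proof (rule poly_timeI[of _ "Fork p q"])
    show "poly_bounded e D (\<lambda>x. 1 + S x + T x)"
      using * by (intro poly_bounded_intros)
    show "\<exists>t. exec (Fork p q) (e x) (enc_pair e1 e2 (f x, g x)) t \<and> t \<le> 1 + S x + T x" if "x \<in> D" for x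
      using exec_Fork[OF *(1)[OF that] *(3)[OF that]] by (intro exI conjI) auto
  qed
qed

lemma poly_time_comp2:
  assumes "poly_time (enc_pair e1 e2) e' E (\<lambda>p. F (fst p) (snd p))"
    "poly_time e e1 D f" "poly_time e e2 D g" "\<And>x. x \<in> D \<Longrightarrow> (f x, g x) \<in> E"
  shows "poly_time e e' D (\<lambda>x. F (f x) (g x))"
  using poly_time_comp[OF assms(1) poly_time_pair[OF assms(2,3)] assms(4)] by simp

lemma poly_time_fst: "poly_time e (enc_pair e1 e2) D f \<Longrightarrow> poly_time e e1 D (\<lambda>x. fst (f x))"
  by (rule poly_time_comp[where E = UNIV and g = fst], rule poly_time_prim[of _ Fst])
    (auto simp: enc_pair_def intro!: poly_bounded_mono[OF poly_bounded_vsize])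

lemma poly_time_snd: "poly_time e (enc_pair e1 e2) D f \<Longrightarrow> poly_time e e2 D (\<lambda>x. snd (f x))"
  by (rule poly_time_comp[where E = UNIV and g = snd], rule poly_time_prim[of _ Snd])
    (auto simp: enc_pair_def intro!: poly_bounded_mono[OF poly_bounded_vsize])

definition enc_bool :: "bool \<Rightarrow> val" where
  "enc_bool b = Num (if b then 1 else 0)"

lemma poly_time_if:
  assumes "poly_time e enc_bool D b"
    "poly_time e e' {x \<in> D. b x} f" "poly_time e e' {x \<in> D. \<not> b x} g"
  shows "poly_time e e' D (\<lambda>x. if b x then f x else g x)"
proof (rule poly_timeE[OF assms(1)], rule poly_timeE[OF assms(2)], rule poly_timeE[OF assms(3)])
  fix p S q T r U
  assume *: "\<And>x. x \<in> D \<Longrightarrow> exec p (e x) (enc_bool (b x)) (S x)" "poly_bounded e D S"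
    "\<And>x. x \<in> {x \<in> D. b x} \<Longrightarrow> exec q (e x) (e' (f x)) (T x)" "poly_bounded e {x \<in> D. b x} T"
    "\<And>x. x \<in> {x \<in> D. \<not> b x} \<Longrightarrow> exec r (e x) (e' (g x)) (U x)" "poly_bounded e {x \<in> D. \<not> b x} U"
  have b: "poly_bounded e D (\<lambda>x. if b x then T x else 0)"
    "poly_bounded e D (\<lambda>x. if b x then 0 else U x)"
    using *(4,6) unfolding poly_bounded_def by fastforce+
  show ?thesis
  proof (rule poly_timeI[of _ "Cond p q r"])
    show "poly_bounded e D (\<lambda>x. S x + ((if b x then T x else 0) + (if b x then 0 else U x)))"
      using * b by (intro poly_bounded_add)
    show "\<exists>t. exec (Cond p q r) (e x) (e' (if b x then f x else g x)) t \<and>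
       t \<le> S x + ((if b x then T x else 0) + (if b x then 0 else U x))" if "x \<in> D" for x
    proof (cases "b x")
      case True
      then have "exec (Cond p q r) (e x) (e' (f x)) (S x + T x)"
        using *(1)[OF that] *(3)[of x] that by (intro exec_CondT[of p _ "Num 1"]) (auto simp: enc_bool_def)
      then show ?thesis using True by auto
    next
      case False
      then have "exec (Cond p q r) (e x) (e' (g x)) (S x + U x)"
        using *(1)[OF that] *(5)[of x] that by (intro exec_CondF[of p]) (auto simp: enc_bool_def)
      then show ?thesis using False by auto
    qed
  qed
qed

lemma poly_time_conj:
  assumes "poly_time e enc_bool D P" "poly_time e enc_bool {x \<in> D. P x} Q"
  shows "poly_time e enc_bool D (\<lambda>x. P x \<and> Q x)"
  by (rule poly_time_cong[OF poly_time_if[OF assms poly_time_const[of _ _ _ False]]]) simp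

subsection \<open>Arithmetic\<close>

lemma bitlen_le_iff_abs: "nat (bitlen \<bar>i\<bar>) \<le> m \<longleftrightarrow> \<bar>i\<bar> < 2 ^ m"
proof -
  have "bitlen \<bar>i\<bar> \<le> int m \<longleftrightarrow> \<bar>i\<bar> < 2 ^ m"
    using bitlen_le_iff_power[of "\<bar>i\<bar>" m] by simp
  then show ?thesis by (simp add: nat_le_iff)
qed

lemma abs_less_power_bitlen: "\<bar>i\<bar> < 2 ^ nat (bitlen \<bar>i\<bar>)"
  using bitlen_le_iff_abs by blast

lemma abs_le_power_bitlen: "\<bar>i\<bar> \<le> 2 ^ nat (bitlen \<bar>i\<bar>) - 1"
  using abs_less_power_bitlen[of i] by linarith

lemma vsize_Num_mono: "\<bar>i\<bar> \<le> \<bar>j\<bar> \<Longrightarrow> vsize (Num i) \<le> vsize (Num j)"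
  using bitlen_le_iff_abs[of i "nat (bitlen \<bar>j\<bar>)"] abs_less_power_bitlen[of j] by simp

lemma vsize_Num_le: "vsize (Num (int n)) \<le> Suc n"
proof -
  have "\<bar>int n\<bar> < 2 ^ n" using of_nat_less_two_power[of n, where 'a = int] by simp
  then show ?thesis using bitlen_le_iff_abs[of "int n" n] by simp
qed

lemma vsize_Num_add: "vsize (Num (i + j)) + 1 \<le> vsize (Num i) + vsize (Num j)"
proof -
  define a b where "a = nat (bitlen \<bar>i\<bar>)" and "b = nat (bitlen \<bar>j\<bar>)"
  have "((2::int) ^ a - 1) * (2 ^ b - 1) \<ge> 0" by simp
  then have "(2::int) ^ a + 2 ^ b \<le> 2 ^ (a + b) + 1"
    by (simp add: algebra_simps power_add)
  then have "\<bar>i + j\<bar> < 2 ^ (a + b)"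
    using abs_le_power_bitlen[of i] abs_le_power_bitlen[of j] abs_triangle_ineq[of i j]
    unfolding a_def b_def by linarith
  then show ?thesis using bitlen_le_iff_abs[of "i + j" "a + b"] by (simp add: a_def b_def)
qed

lemma vsize_Num_diff: "vsize (Num (i - j)) + 1 \<le> vsize (Num i) + vsize (Num j)"
  using vsize_Num_add[of i "- j"] by simp

lemma vsize_Num_mult: "vsize (Num (i * j)) + 1 \<le> vsize (Num i) + vsize (Num j)"
proof -
  define a b where "a = nat (bitlen \<bar>i\<bar>)" and "b = nat (bitlen \<bar>j\<bar>)"
  have "\<bar>i * j\<bar> < 2 ^ (a + b)"
    unfolding abs_mult power_add a_def b_def
    by (intro mult_strict_mono') (auto intro: abs_less_power_bitlen)
  then show ?thesis using bitlen_le_iff_abs[of "i * j" "a + b"] by (simp add: a_def b_def)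
qed

lemma vsize_Num_div: "vsize (Num (i div j)) \<le> vsize (Num i)"
proof (rule vsize_Num_mono)
  show "\<bar>i div j\<bar> \<le> \<bar>i\<bar>"
  proof (cases "j = 0")
    case False
    then have j: "1 \<le> \<bar>j\<bar>" by simp
    have m: "\<bar>i mod j\<bar> < \<bar>j\<bar>" using False by (rule abs_mod_less)
    have "\<bar>i div j\<bar> * \<bar>j\<bar> = \<bar>i - i mod j\<bar>"
      by (metis abs_mult minus_mod_eq_div_mult)
    then have "\<bar>i div j\<bar> * \<bar>j\<bar> < \<bar>i\<bar> + \<bar>j\<bar>"
      using m abs_triangle_ineq4[of i "i mod j"] by linarith
    then have lt: "(\<bar>i div j\<bar> - 1) * \<bar>j\<bar> < \<bar>i\<bar>" by (simp add: algebra_simps)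
    show ?thesis
    proof (rule ccontr)
      assume "\<not> ?thesis"
      then have "\<bar>i\<bar> * 1 \<le> (\<bar>i div j\<bar> - 1) * \<bar>j\<bar>" using j by (intro mult_mono) auto
      with lt show False by simp
    qed
  qed auto
qed

lemma poly_time_binop:
  assumes "\<And>i j. prim_val g (Node (Num i) (Num j)) = Num (F i j)"
    "\<And>i j. vsize (Num (F i j)) \<le> vsize (Num i) + vsize (Num j)"
    "poly_time e Num D f" "poly_time e Num D h"
  shows "poly_time e Num D (\<lambda>x. F (f x) (h x))"
proof (rule poly_time_comp2[OF _ assms(3,4), where E = UNIV])
  show "poly_time (enc_pair Num Num) Num UNIV (\<lambda>p. F (fst p) (snd p))"
  proof (rule poly_time_prim[of _ g])
    show "poly_bounded (enc_pair Num Num) UNIV (\<lambda>x. vsize (Num (F (fst x) (snd x))))"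
    proof (rule poly_bounded_mono[OF poly_bounded_vsize])
      show "vsize (Num (F (fst x) (snd x))) \<le> vsize (enc_pair Num Num x)" for x
        using assms(2)[of "fst x" "snd x"] by (cases x) (simp del: vsize.simps add: vsize.simps(2))
    qed
  qed (auto simp: assms(1) enc_pair_def)
qed auto

lemma poly_time_add:
  "poly_time e Num D f \<Longrightarrow> poly_time e Num D g \<Longrightarrow> poly_time e Num D (\<lambda>x. f x + g x)"
  by (rule poly_time_binop[of Add "(+)"]) (use add_leD1[OF vsize_Num_add] in simp_all)

lemma poly_time_diff:
  "poly_time e Num D f \<Longrightarrow> poly_time e Num D g \<Longrightarrow> poly_time e Num D (\<lambda>x. f x - g x)"
  by (rule poly_time_binop[of Sub "(-)"]) (use add_leD1[OF vsize_Num_diff] in simp_all)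

lemma poly_time_mult:
  "poly_time e Num D f \<Longrightarrow> poly_time e Num D g \<Longrightarrow> poly_time e Num D (\<lambda>x. f x * g x)"
  by (rule poly_time_binop[of Mul "(*)"]) (use add_leD1[OF vsize_Num_mult] in simp_all)

lemma poly_time_div:
  "poly_time e Num D f \<Longrightarrow> poly_time e Num D g \<Longrightarrow> poly_time e Num D (\<lambda>x. f x div g x)"
  by (rule poly_time_binop[of Div "(div)"])
    (use trans_le_add1[OF vsize_Num_div] in \<open>simp_all del: vsize.simps\<close>)

lemma poly_time_le:
  assumes "poly_time e Num D f" "poly_time e Num D g"
  shows "poly_time e enc_bool D (\<lambda>x. f x \<le> g x)"
proof (rule poly_time_comp2[OF _ assms, where E = UNIV])
  show "poly_time (enc_pair Num Num) enc_bool UNIV (\<lambda>p. fst p \<le> snd p)"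
    by (rule poly_time_prim[of _ Leq])
      (auto simp: enc_pair_def enc_bool_def bitlen_def floorlog_mono
        intro!: poly_bounded_mono[OF poly_bounded_const[of _ _ "vsize (Num 1)"]])
qed auto

lemma poly_time_int: "poly_time e enc_nat D f \<Longrightarrow> poly_time e Num D (\<lambda>x. int (f x))"
  by (erule poly_time_cong) (simp add: enc_nat_def)

lemma poly_time_nat:
  "poly_time e Num D f \<Longrightarrow> (\<And>x. x \<in> D \<Longrightarrow> 0 \<le> f x) \<Longrightarrow> poly_time e enc_nat D (\<lambda>x. nat (f x))"
  by (erule poly_time_cong) (simp add: enc_nat_def)

lemma poly_time_le_nat:
  assumes "poly_time e enc_nat D f" "poly_time e enc_nat D g"
  shows "poly_time e enc_bool D (\<lambda>x. f x \<le> g x)"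
  using poly_time_le[OF assms[THEN poly_time_int]] by simp

lemma poly_time_eq_nat:
  assumes "poly_time e enc_nat D f" "poly_time e enc_nat D g"
  shows "poly_time e enc_bool D (\<lambda>x. f x = g x)"
  by (rule poly_time_cong[OF poly_time_conj[OF poly_time_le_nat[OF assms]
      poly_time_subset[OF poly_time_le_nat[OF assms(2,1)]]]]) (auto simp: order_eq_iff)

lemma poly_time_Suc: "poly_time e enc_nat D f \<Longrightarrow> poly_time e enc_nat D (\<lambda>x. Suc (f x))"
  by (rule poly_time_cong[OF poly_time_add[OF poly_time_int poly_time_const[of _ _ _ 1]]])
    (auto simp: enc_nat_def)

lemma poly_time_min:
  assumes "poly_time e Num D f" "poly_time e Num D g"
  shows "poly_time e Num D (\<lambda>x. min (f x) (g x))"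
  unfolding min_def
  by (intro poly_time_if poly_time_le assms poly_time_subset[OF assms(1)] poly_time_subset[OF assms(2)]) auto

lemma poly_time_option:
  assumes "poly_time e enc_option D r" "poly_time e e' {x \<in> D. r x = None} f"
    "poly_time (enc_pair e enc_nat) e' {(x, v). x \<in> D \<and> r x = Some v} (\<lambda>p. g (fst p) (snd p))"
  shows "poly_time e e' D (\<lambda>x. case r x of None \<Rightarrow> f x | Some v \<Rightarrow> g x v)"
proof -
  define i where "i x = (case r x of None \<Rightarrow> - 1 | Some v \<Rightarrow> int v)" for x
  have i: "poly_time e Num D i"
    by (rule poly_time_cong[OF assms(1)]) (auto simp: i_def split: option.split)
  have iff: "0 \<le> i x \<longleftrightarrow> r x \<noteq> None" for x
    by (auto simp: i_def split: option.split)
  have "poly_time e e' D (\<lambda>x. if 0 \<le> i x then g x (nat (i x)) else f x)"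
  proof (intro poly_time_if poly_time_le poly_time_const i)
    show "poly_time e e' {x \<in> D. 0 \<le> i x} (\<lambda>x. g x (nat (i x)))"
    proof (rule poly_time_comp2[OF assms(3)])
      show "poly_time e enc_nat {x \<in> D. 0 \<le> i x} (\<lambda>x. nat (i x))"
        by (intro poly_time_nat poly_time_subset[OF i]) auto
    qed (auto simp: i_def intro: poly_time_id split: option.splits)
    show "poly_time e e' {x \<in> D. \<not> 0 \<le> i x} f"
      by (rule poly_time_subset[OF assms(2)]) (auto simp: iff)
  qed
  then show ?thesis
    by (rule poly_time_cong) (auto simp: i_def split: option.split)
qed

lemma poly_time_num: "poly_time e enc_rat D f \<Longrightarrow> poly_time e Num D (\<lambda>x. fst (quotient_of (f x)))"
  by (rule poly_time_fst[of _ Num Num], erule poly_time_cong) (auto simp: enc_rat_def enc_pair_def split: prod.split)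

lemma poly_time_den: "poly_time e enc_rat D f \<Longrightarrow> poly_time e Num D (\<lambda>x. snd (quotient_of (f x)))"
  by (rule poly_time_snd[of _ Num Num], erule poly_time_cong) (auto simp: enc_rat_def enc_pair_def split: prod.split)

subsection \<open>Lists\<close>

lemma vsize_enc_list: "vsize (enc_list e xs) = 1 + (\<Sum>x\<leftarrow>xs. 1 + vsize (e x))"
  by (induction xs) auto

lemma vsize_enc_list_le:
  assumes "\<And>x. x \<in> set xs \<Longrightarrow> vsize (e x) \<le> b"
  shows "vsize (enc_list e xs) \<le> 1 + length xs * (1 + b)"
  using assms
proof (induction xs)
  case (Cons x xs)
  then have "vsize (enc_list e xs) \<le> 1 + length xs * (1 + b)" "vsize (e x) \<le> b" by auto
  then show ?case by simp
qed auto

lemma vsize_enc_list_append: "vsize (enc_list e (xs @ ys)) + 1 = vsize (enc_list e xs) + vsize (enc_list e ys)"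
  by (simp add: vsize_enc_list)

lemma vsize_enc_list_rev: "vsize (enc_list e (rev xs)) = vsize (enc_list e xs)"
  by (simp add: vsize_enc_list flip: rev_map)

lemma length_le_vsize: "length xs < vsize (enc_list e xs)"
  by (induction xs) auto

lemma vsize_enc_list_member: "x \<in> set xs \<Longrightarrow> vsize (e x) < vsize (enc_list e xs)"
  by (induction xs) auto

lemma poly_time_Nil: "poly_time e (enc_list a) D (\<lambda>_. [])"
  by (rule poly_time_const)

lemma poly_time_Cons:
  assumes "poly_time e a D f" "poly_time e (enc_list a) D g"
  shows "poly_time e (enc_list a) D (\<lambda>x. f x # g x)"
  by (rule poly_time_cong[OF poly_time_pair[OF assms]]) auto

definition fold_body :: "prog \<Rightarrow> prog" where
  "fold_body p = Fork (Prim Fst)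
     (Fork (Seq (Fork (Prim Fst) (Fork (Seq (Prim Snd) (Prim Fst))
              (Seq (Prim Snd) (Seq (Prim Snd) (Prim Fst))))) p)
           (Seq (Prim Snd) (Seq (Prim Snd) (Prim Snd))))"

definition fold_test :: prog where
  "fold_test = Seq (Prim Snd) (Seq (Prim Snd) (Prim IsNode))"

lemma exec_fold_test:
  "\<exists>t. exec fold_test (Node x (Node s l)) (prim_val IsNode l) t \<and>
     t \<le> 30 + 10 * (vsize x + vsize s + vsize l)"
proof -
  have "vsize (prim_val IsNode l) \<le> 2" by (cases l) (auto simp: bitlen_def floorlog_def)
  moreover have "exec fold_test (Node x (Node s l)) (prim_val IsNode l)
    ((1 + vsize (Node x (Node s l)) + vsize (Node s l)) +
     ((1 + vsize (Node s l) + vsize l) + (1 + vsize l + vsize (prim_val IsNode l))))"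
    unfolding fold_test_def
    using exec_Prim[of Snd "Node x (Node s l)"] exec_Prim[of Snd "Node s l"] exec_Prim[of IsNode l]
    by (intro exec_Seq) auto
  ultimately show ?thesis by (intro exI conjI) auto
qed

lemma exec_fold_body:
  assumes "exec p (Node x (Node s a)) s' t"
  shows "\<exists>u. exec (fold_body p) (Node x (Node s (Node a l))) (Node x (Node s' l)) u \<and>
     u \<le> 100 + 20 * (vsize x + vsize s + vsize (Node a l)) + t"
proof -
  define y where "y = Node x (Node s (Node a l))"
  have *: "exec (Prim Fst) y x (1 + vsize y + vsize x)"
    "exec (Prim Snd) y (Node s (Node a l)) (1 + vsize y + vsize (Node s (Node a l)))"
    "exec (Prim Fst) (Node s (Node a l)) s (1 + vsize (Node s (Node a l)) + vsize s)"
    "exec (Prim Snd) (Node s (Node a l)) (Node a l) (1 + vsize (Node s (Node a l)) + vsize (Node a l))"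
    "exec (Prim Fst) (Node a l) a (1 + vsize (Node a l) + vsize a)"
    "exec (Prim Snd) (Node a l) l (1 + vsize (Node a l) + vsize l)"
    using exec_Prim[of Fst y] exec_Prim[of Snd y] exec_Prim[of Fst "Node s (Node a l)"]
      exec_Prim[of Snd "Node s (Node a l)"] exec_Prim[of Fst "Node a l"] exec_Prim[of Snd "Node a l"]
    by (auto simp: y_def)
  have "exec (fold_body p) y (Node x (Node s' l))
    (1 + (1 + vsize y + vsize x) +
     (1 + ((1 + (1 + vsize y + vsize x) +
       (1 + ((1 + vsize y + vsize (Node s (Node a l))) + (1 + vsize (Node s (Node a l)) + vsize s)) +
         ((1 + vsize y + vsize (Node s (Node a l))) +
           ((1 + vsize (Node s (Node a l)) + vsize (Node a l)) + (1 + vsize (Node a l) + vsize a))))) + t) +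
      ((1 + vsize y + vsize (Node s (Node a l))) +
        ((1 + vsize (Node s (Node a l)) + vsize (Node a l)) + (1 + vsize (Node a l) + vsize l)))))"
    unfolding fold_body_def
    by (rule exec_Fork[OF *(1) exec_Fork[OF exec_Seq[OF exec_Fork[OF *(1) exec_Fork[OF exec_Seq[OF *(2,3)]
            exec_Seq[OF *(2) exec_Seq[OF *(4,5)]]]] assms] exec_Seq[OF *(2) exec_Seq[OF *(4,6)]]]])
  then show ?thesis unfolding y_def by (intro exI conjI) auto
qed

text \<open>A fold need not be polynomial even if its step function is, since the state may grow
  exponentially; hence the bound \<open>B\<close> on the intermediate states.\<close>

lemma poly_time_foldl:
  assumes step: "poly_time (enc_pair e (enc_pair es ea)) es E (\<lambda>p. g (fst p) (fst (snd p)) (snd (snd p)))"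
    and init: "poly_time e es D s" and list: "poly_time e (enc_list ea) D xs"
    and inv: "\<And>x ys a zs. x \<in> D \<Longrightarrow> xs x = ys @ a # zs \<Longrightarrow> (x, foldl (g x) (s x) ys, a) \<in> E"
    and bound: "poly_bounded e D B"
      "\<And>x ys zs. x \<in> D \<Longrightarrow> xs x = ys @ zs \<Longrightarrow> vsize (es (foldl (g x) (s x) ys)) \<le> B x"
  shows "poly_time e es D (\<lambda>x. foldl (g x) (s x) (xs x))"
proof -
  obtain p c k where p: "\<And>y. y \<in> E \<Longrightarrow> \<exists>t. exec p (enc_pair e (enc_pair es ea) y)
      (es (g (fst y) (fst (snd y)) (snd (snd y)))) t \<and> t \<le> c * vsize (enc_pair e (enc_pair es ea) y) ^ k"
    using step unfolding poly_time_def by blast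
  obtain q1 T1 where q1: "\<And>x. x \<in> D \<Longrightarrow> exec q1 (e x) (es (s x)) (T1 x)" "poly_bounded e D T1"
    using init by (elim poly_timeE) blast
  obtain q2 T2 where q2: "\<And>x. x \<in> D \<Longrightarrow> exec q2 (e x) (enc_list ea (xs x)) (T2 x)" "poly_bounded e D T2"
    "\<And>x. x \<in> D \<Longrightarrow> vsize (enc_list ea (xs x)) \<le> T2 x"
    using list by (elim poly_timeE) blast
  define S where "S x = vsize (e x) + B x + T2 x" for x
  define M where "M x = 200 + 40 * S x + c * (2 + S x) ^ k" for x
  define loop where "loop = While fold_test (fold_body p)"
  have loop: "\<exists>t. exec loop (Node (e x) (Node (es (foldl (g x) (s x) ys)) (enc_list ea zs)))
      (Node (e x) (Node (es (foldl (g x) (s x) (xs x))) (Num 0))) t \<and> t \<le> (length zs + 1) * M x"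
    if x: "x \<in> D" "xs x = ys @ zs" for x ys zs
    using x(2)
  proof (induction zs arbitrary: ys)
    case Nil
    have le: "vsize (es (foldl (g x) (s x) ys)) \<le> B x" using bound(2)[OF x(1) Nil] .
    have "vsize (Num 0) \<le> T2 x" using q2(3)[OF x(1)] one_le_vsize[of "enc_list ea (xs x)"]
      by (simp add: bitlen_def floorlog_def del: one_le_vsize)
    moreover obtain t where "exec fold_test (Node (e x) (Node (es (foldl (g x) (s x) ys)) (Num 0))) (Num 0) t"
      "t \<le> 30 + 10 * (vsize (e x) + vsize (es (foldl (g x) (s x) ys)) + vsize (Num 0))"
      using exec_fold_test[of "e x" "es (foldl (g x) (s x) ys)" "Num 0"] by auto
    ultimately show ?case
      using Nil le unfolding loop_def
      by (intro exI[of _ t] conjI) (auto intro: exec_WhileF simp: M_def S_def simp del: vsize.simps)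
  next
    case (Cons a zs)
    define st where "st = foldl (g x) (s x) ys"
    define l where "l = enc_list ea zs"
    have E: "(x, st, a) \<in> E" using inv[OF x(1) Cons.prems] by (simp add: st_def)
    have le: "vsize (es st) \<le> B x" using bound(2)[OF x(1) Cons.prems] by (simp add: st_def)
    have "vsize (enc_list ea (a # zs)) \<le> vsize (enc_list ea (xs x))"
      unfolding Cons.prems
      using vsize_enc_list_append[of ea ys "a # zs"] one_le_vsize[of "enc_list ea ys"] by linarith
    then have l: "vsize (Node (ea a) l) \<le> T2 x" using q2(3)[OF x(1)] by (simp add: l_def)
    obtain t1 where t1: "exec fold_test (Node (e x) (Node (es st) (Node (ea a) l))) (Num 1) t1"
      "t1 \<le> 30 + 10 * (vsize (e x) + vsize (es st) + vsize (Node (ea a) l))"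
      using exec_fold_test[of "e x" "es st" "Node (ea a) l"] by auto
    obtain t where t: "exec p (Node (e x) (Node (es st) (ea a))) (es (g x st a)) t"
      "t \<le> c * vsize (Node (e x) (Node (es st) (ea a))) ^ k"
      using p[OF E] by auto
    have "vsize (Node (e x) (Node (es st) (ea a))) \<le> 2 + S x" using le l by (simp add: S_def)
    then have t': "t \<le> c * (2 + S x) ^ k"
      using t(2) by (meson le_trans mult_le_mono2 power_mono zero_le)
    obtain t2 where t2: "exec (fold_body p) (Node (e x) (Node (es st) (Node (ea a) l))) (Node (e x) (Node (es (g x st a)) l)) t2"
      "t2 \<le> 100 + 20 * (vsize (e x) + vsize (es st) + vsize (Node (ea a) l)) + t"
      using exec_fold_body[OF t(1)] by blast
    obtain t3 where t3: "exec loop (Node (e x) (Node (es (g x st a)) l))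
      (Node (e x) (Node (es (foldl (g x) (s x) (xs x))) (Num 0))) t3" "t3 \<le> (length zs + 1) * M x"
      using Cons.IH[of "ys @ [a]"] Cons.prems by (auto simp: st_def l_def)
    have "exec loop (Node (e x) (Node (es st) (Node (ea a) l)))
      (Node (e x) (Node (es (foldl (g x) (s x) (xs x))) (Num 0))) (t1 + t2 + t3)"
      unfolding loop_def by (rule exec_WhileT[OF t1(1) _ t2(1) t3(1)[unfolded loop_def]]) simp
    moreover have "vsize (e x) + vsize (es st) + vsize (Node (ea a) l) \<le> S x"
      using le l unfolding S_def by linarith
    then have "t1 + t2 \<le> M x"
      using add_mono[OF t1(2) t2(2)] t' unfolding M_def
      by (elim order_trans) (simp del: vsize.simps)
    then have "t1 + t2 + t3 \<le> (length (a # zs) + 1) * M x"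
      using t3(2) by simp
    ultimately show ?case unfolding st_def l_def by auto
  qed
  define q where "q = Seq (Fork (Prim Ident) (Fork q1 q2)) (Seq loop (Seq (Prim Snd) (Prim Fst)))"
  show ?thesis
  proof (rule poly_timeI[of _ q])
    show "poly_bounded e D (\<lambda>x. 20 + 10 * S x + T1 x + T2 x + (T2 x + 1) * M x)"
      unfolding M_def S_def by (intro poly_bounded_intros bound q1 q2)
    fix x assume x: "x \<in> D"
    define r where "r = es (foldl (g x) (s x) (xs x))"
    obtain t where t: "exec loop (Node (e x) (Node (es (s x)) (enc_list ea (xs x)))) (Node (e x) (Node r (Num 0))) t"
      "t \<le> (length (xs x) + 1) * M x"
      using loop[OF x, of "[]" "xs x"] by (auto simp: r_def)
    have "length (xs x) \<le> T2 x" using length_le_vsize[of "xs x" ea] q2(3)[OF x] by linarith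
    then have t': "t \<le> (T2 x + 1) * M x" using t(2) by (meson add_mono le_refl le_trans mult_le_mono)
    have r: "vsize r \<le> B x" using bound(2)[OF x, of "xs x" "[]"] by (simp add: r_def)
    have "exec q (e x) r ((1 + (1 + vsize (e x) + vsize (e x)) + (1 + T1 x + T2 x)) +
      (t + ((1 + vsize (Node (e x) (Node r (Num 0))) + vsize (Node r (Num 0))) +
        (1 + vsize (Node r (Num 0)) + vsize r))))"
      unfolding q_def
      by (rule exec_Seq[OF exec_Fork[OF exec_Prim[of Ident "e x", simplified prim_val.simps] exec_Fork[OF q1(1)[OF x] q2(1)[OF x]]]
            exec_Seq[OF t(1) exec_Seq[OF exec_Prim[of Snd "Node (e x) (Node r (Num 0))", simplified prim_val.simps]
              exec_Prim[of Fst "Node r (Num 0)", simplified prim_val.simps]]]])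
    then show "\<exists>t. exec q (e x) (es (foldl (g x) (s x) (xs x))) t \<and>
        t \<le> 20 + 10 * S x + T1 x + T2 x + (T2 x + 1) * M x"
      using t' r unfolding r_def S_def
      by (intro exI conjI) (assumption, simp add: bitlen_def floorlog_def)
  qed
qed

lemma poly_time_proj1:
  "poly_time e e' D f \<Longrightarrow> (\<And>p. p \<in> E \<Longrightarrow> fst p \<in> D) \<Longrightarrow> poly_time (enc_pair e ea) e' E (\<lambda>p. f (fst p))"
  by (rule poly_time_comp[OF _ poly_time_fst[OF poly_time_id]])

lemma poly_time_rev:
  assumes "poly_time e (enc_list a) D f"
  shows "poly_time e (enc_list a) D (\<lambda>x. rev (f x))"
proof -
  have fold: "foldl (\<lambda>l y. y # l) [] xs = rev xs" for xs :: "'b list"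
    by (induction xs rule: rev_induct) auto
  have "poly_time e (enc_list a) D (\<lambda>x. foldl (\<lambda>l y. y # l) [] (f x))"
  proof (rule poly_time_foldl[where E = UNIV, OF _ poly_time_Nil assms])
    show "poly_time (enc_pair e (enc_pair (enc_list a) a)) (enc_list a) UNIV (\<lambda>p. snd (snd p) # fst (snd p))"
      by (rule poly_time_Cons poly_time_fst poly_time_snd poly_time_id)+
    show "vsize (enc_list a (foldl (\<lambda>l y. y # l) [] ys)) \<le> vsize (enc_list a (f x))"
      if "f x = ys @ zs" for x ys zs
      using vsize_enc_list_append[of a ys zs] one_le_vsize[of "enc_list a zs"]
      unfolding that fold vsize_enc_list_rev by linarith
  qed (auto intro: poly_time_size[OF assms])
  then show ?thesis unfolding fold .
qed

lemma poly_time_snoc: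
  assumes "poly_time e (enc_list a) D f" "poly_time e a D g"
  shows "poly_time e (enc_list a) D (\<lambda>x. f x @ [g x])"
  using poly_time_rev[OF poly_time_Cons[OF assms(2) poly_time_rev[OF assms(1)]]] by simp

lemma poly_time_map:
  assumes f: "poly_time (enc_pair e a) b E (\<lambda>p. f (fst p) (snd p))"
    and xs: "poly_time e (enc_list a) D xs"
    and E: "\<And>x y. x \<in> D \<Longrightarrow> y \<in> set (xs x) \<Longrightarrow> (x, y) \<in> E"
  shows "poly_time e (enc_list b) D (\<lambda>x. map (f x) (xs x))"
proof -
  have fold: "foldl (\<lambda>l y. f x y # l) [] ys = rev (map (f x) ys)" for x ys
    by (induction ys rule: rev_induct) auto
  obtain c k where ck: "\<And>p. p \<in> E \<Longrightarrow> vsize (b (f (fst p) (snd p))) \<le> c * vsize (enc_pair e a p) ^ k"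
    using poly_time_size[OF f] unfolding poly_bounded_def by blast
  define B where "B x = 1 + vsize (enc_list a (xs x)) *
    (1 + c * (1 + vsize (e x) + vsize (enc_list a (xs x))) ^ k)" for x
  have "poly_time e (enc_list b) D (\<lambda>x. foldl (\<lambda>l y. f x y # l) [] (xs x))"
  proof (rule poly_time_foldl[where E = "{(x, l, y). (x, y) \<in> E}" and B = B, OF _ poly_time_Nil xs])
    show "poly_time (enc_pair e (enc_pair (enc_list b) a)) (enc_list b) {(x, l, y). (x, y) \<in> E}
      (\<lambda>p. f (fst p) (snd (snd p)) # fst (snd p))"
      by (intro poly_time_Cons poly_time_comp2[OF f] poly_time_fst poly_time_snd; (rule poly_time_id)?) auto
    show "poly_bounded e D B"
      unfolding B_def by (intro poly_bounded_intros poly_time_size[OF xs])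
    fix x ys zs assume x: "x \<in> D" "xs x = ys @ zs"
    have "vsize (b (f x y)) \<le> c * (1 + vsize (e x) + vsize (enc_list a (xs x))) ^ k" if "y \<in> set ys" for y
    proof -
      have y: "y \<in> set (xs x)" using that x by auto
      have "vsize (b (f x y)) \<le> c * vsize (Node (e x) (a y)) ^ k"
        using ck[OF E[OF x(1) y]] by simp
      also have "\<dots> \<le> c * (1 + vsize (e x) + vsize (enc_list a (xs x))) ^ k"
        using vsize_enc_list_member[OF y, of a] by (intro mult_le_mono2 power_mono) auto
      finally show ?thesis .
    qed
    then have "vsize (enc_list b (map (f x) ys)) \<le> 1 + length (map (f x) ys) *
      (1 + c * (1 + vsize (e x) + vsize (enc_list a (xs x))) ^ k)"
      by (intro vsize_enc_list_le) auto
    also have "\<dots> \<le> B x"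
      using length_le_vsize[of "xs x" a] x unfolding B_def by (intro add_mono mult_le_mono) auto
    finally show "vsize (enc_list b (foldl (\<lambda>l y. f x y # l) [] ys)) \<le> B x"
      unfolding fold vsize_enc_list_rev .
  qed (auto intro: E)
  from poly_time_rev[OF this] show ?thesis unfolding fold by simp
qed

lemma poly_time_sum_prod_list:
  assumes "poly_time e (enc_list Num) D f"
  shows poly_time_sum_list: "poly_time e Num D (\<lambda>x. sum_list (f x))"
    and poly_time_prod_list: "poly_time e Num D (\<lambda>x. prod_list (f x))"
proof -
  have fold: "foldl (+) i xs = i + sum_list xs" "foldl (*) i xs = i * prod_list xs" for i :: int and xs
    by (induction xs arbitrary: i) (auto simp: algebra_simps)
  have size: "vsize (Num (sum_list xs)) \<le> 1 + vsize (enc_list Num xs)"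
    "vsize (Num (prod_list xs)) \<le> 1 + vsize (enc_list Num xs)" for xs
  proof (induction xs)
    case (Cons i xs)
    then show "vsize (Num (sum_list (i # xs))) \<le> 1 + vsize (enc_list Num (i # xs))"
      "vsize (Num (prod_list (i # xs))) \<le> 1 + vsize (enc_list Num (i # xs))"
      using vsize_Num_add[of i "sum_list xs"] vsize_Num_mult[of i "prod_list xs"] by auto
  qed (auto simp: bitlen_def floorlog_def)
  have pre: "vsize (enc_list Num ys) \<le> vsize (enc_list Num (ys @ zs))" for ys zs
    using vsize_enc_list_append[of Num ys zs] one_le_vsize[of "enc_list Num zs"] by linarith
  have B: "poly_bounded e D (\<lambda>x. 1 + vsize (enc_list Num (f x)))"
    by (intro poly_bounded_intros poly_time_size[OF assms])
  have "poly_time e Num D (\<lambda>x. foldl (+) 0 (f x))"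
  proof (rule poly_time_foldl[where E = UNIV, OF _ poly_time_const assms _ B])
    show "poly_time (enc_pair e (enc_pair Num Num)) Num UNIV (\<lambda>p. fst (snd p) + snd (snd p))"
      by (rule poly_time_add poly_time_fst poly_time_snd poly_time_id)+
    show "vsize (Num (foldl (+) 0 ys)) \<le> 1 + vsize (enc_list Num (f x))" if "f x = ys @ zs" for x ys zs
      using size(1)[of ys] pre[of ys zs] unfolding that fold by simp
  qed auto
  then show "poly_time e Num D (\<lambda>x. sum_list (f x))" unfolding fold by simp
  have "poly_time e Num D (\<lambda>x. foldl (*) 1 (f x))"
  proof (rule poly_time_foldl[where E = UNIV, OF _ poly_time_const assms _ B])
    show "poly_time (enc_pair e (enc_pair Num Num)) Num UNIV (\<lambda>p. fst (snd p) * snd (snd p))"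
      by (rule poly_time_mult poly_time_fst poly_time_snd poly_time_id)+
    show "vsize (Num (foldl (*) 1 ys)) \<le> 1 + vsize (enc_list Num (f x))" if "f x = ys @ zs" for x ys zs
      using size(2)[of ys] pre[of ys zs] unfolding that fold by simp
  qed auto
  then show "poly_time e Num D (\<lambda>x. prod_list (f x))" unfolding fold by simp
qed

lemma poly_time_length:
  assumes "poly_time e (enc_list a) D f"
  shows "poly_time e enc_nat D (\<lambda>x. length (f x))"
proof -
  have "poly_time e enc_nat D (\<lambda>x. nat (sum_list (map (\<lambda>_. 1) (f x))))"
    by (rule poly_time_nat, rule poly_time_sum_list, rule poly_time_map[where E = UNIV, OF _ assms])
      (auto intro: poly_time_const simp: sum_list_triv)
  then show ?thesis by (simp add: sum_list_triv)
qed

lemma poly_time_upt_length: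
  assumes "poly_time e (enc_list a) D f"
  shows "poly_time e (enc_list enc_nat) D (\<lambda>x. [0..<length (f x)])"
proof -
  have fold: "foldl (\<lambda>l _. length l # l) [] ys = rev [0..<length ys]" for ys :: "'b list"
    by (induction ys rule: rev_induct) auto
  define B where "B x = 1 + vsize (enc_list a (f x)) * (1 + vsize (enc_list a (f x)))" for x
  have "poly_time e (enc_list enc_nat) D (\<lambda>x. foldl (\<lambda>l _. length l # l) [] (f x))"
  proof (rule poly_time_foldl[where E = UNIV and B = B, OF _ poly_time_Nil assms])
    show "poly_time (enc_pair e (enc_pair (enc_list enc_nat) a)) (enc_list enc_nat) UNIV
      (\<lambda>p. length (fst (snd p)) # fst (snd p))"
      by (rule poly_time_Cons poly_time_length poly_time_fst poly_time_snd poly_time_id)+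
    show "poly_bounded e D B"
      unfolding B_def by (intro poly_bounded_intros poly_time_size[OF assms])
    fix x ys zs assume x: "f x = ys @ zs"
    have len: "length (f x) < vsize (enc_list a (f x))" by (rule length_le_vsize)
    have "vsize (enc_nat i) \<le> vsize (enc_list a (f x))" if "i < length ys" for i
      using vsize_Num_le[of i] that len x by (simp add: enc_nat_def)
    then have "vsize (enc_list enc_nat [0..<length ys]) \<le>
      1 + length [0..<length ys] * (1 + vsize (enc_list a (f x)))"
      by (intro vsize_enc_list_le) auto
    also have "\<dots> \<le> B x"
      using len x unfolding B_def by (intro add_mono mult_le_mono) auto
    finally show "vsize (enc_list enc_nat (foldl (\<lambda>l _. length l # l) [] ys)) \<le> B x"
      unfolding fold vsize_enc_list_rev .
  qed auto
  from poly_time_rev[OF this] show ?thesis unfolding fold by simp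
qed

lemma poly_time_nth:
  fixes a :: "'b \<Rightarrow> val"
  assumes xs: "poly_time e (enc_list a) D xs" and i: "poly_time e enc_nat D i"
    and less: "\<And>x. x \<in> D \<Longrightarrow> i x < length (xs x)"
  shows "poly_time e a D (\<lambda>x. xs x ! i x)"
proof -
  define g where "g x p y = (Suc (fst p), if i x = fst p then y else snd p)" for x p and y :: 'b
  have fold: "foldl (g x) (0, undefined) ys = (length ys, if i x < length ys then ys ! i x else undefined)"
    for x ys
    by (induction ys rule: rev_induct) (auto simp: g_def nth_append)
  define B where "B x = 2 + vsize (a undefined) + 2 * vsize (enc_list a (xs x))" for x
  have "poly_time e (enc_pair enc_nat a) D (\<lambda>x. foldl (g x) (0, undefined) (xs x))"
  proof (rule poly_time_foldl[where E = "D \<times> UNIV" and B = B, OF _ poly_time_const xs])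
    show "poly_time (enc_pair e (enc_pair (enc_pair enc_nat a) a)) (enc_pair enc_nat a) (D \<times> UNIV)
      (\<lambda>p. g (fst p) (fst (snd p)) (snd (snd p)))"
      unfolding g_def
      by (intro poly_time_pair poly_time_Suc poly_time_if poly_time_eq_nat poly_time_proj1[OF i]
          poly_time_fst poly_time_snd; (rule poly_time_id)?) auto
    show "poly_bounded e D B"
      unfolding B_def by (intro poly_bounded_intros poly_time_size[OF xs])
    fix x ys zs assume x: "xs x = ys @ zs"
    have "vsize (enc_nat (length ys)) \<le> vsize (enc_list a (xs x))"
      using vsize_Num_le[of "length ys"] length_le_vsize[of "xs x" a] x by (simp add: enc_nat_def)
    moreover have "vsize (a (ys ! i x)) < vsize (enc_list a (xs x))" if "i x < length ys"
      using x that by (intro vsize_enc_list_member) auto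
    ultimately show "vsize (enc_pair enc_nat a (foldl (g x) (0, undefined) ys)) \<le> B x"
      unfolding fold B_def by (auto simp: less_imp_le_nat intro: order_trans)
  qed auto
  from poly_time_snd[OF this] show ?thesis
    unfolding fold by (rule poly_time_cong) (simp add: less)
qed

section \<open>The CorrKO instance\<close>

definition denominators_prod :: "rat list \<Rightarrow> int" where
  "denominators_prod qs = prod_list (map (\<lambda>q. snd (quotient_of q)) qs)"

definition scale_factor :: "orientkd \<Rightarrow> int" where
  "scale_factor J =
     prod_list (map (\<lambda>u. denominators_prod (map (kdst J u) [0..<knv J])) [0..<knv J])
     * snd (quotient_of (kbudget J))
     * denominators_prod (map (kreward J) [0..<knv J])
     * denominators_prod (map (kweight J) [0..<knv J])
     * denominators_prod (map (kdeadline J) [0..<knv J])"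

definition scaled :: "orientkd \<Rightarrow> rat \<Rightarrow> int" where
  "scaled J q = fst (quotient_of q) * (scale_factor J div snd (quotient_of q))"

definition small_size :: "orientkd \<Rightarrow> nat \<Rightarrow> nat" where
  "small_size J v = (if v < knv J \<and> v \<noteq> kroot J then nat (scaled J (kweight J v)) else 0)"

definition total_size :: "orientkd \<Rightarrow> nat" where
  "total_size J = (\<Sum>v<knv J. small_size J v)"

text \<open>The deadline left for the non-root vertices, truncated so that two large jobs never fit
  into the processing budget.\<close>

definition slack :: "orientkd \<Rightarrow> nat \<Rightarrow> int" where
  "slack J v = min (scaled J (kdeadline J v) - scaled J (kweight J (kroot J))) (int (total_size J))"

definition large_size :: "orientkd \<Rightarrow> nat \<Rightarrow> nat" where
  "large_size J v = nat (int (2 * total_size J + 1) - slack J v + int (small_size J v))"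

definition large_reward :: "orientkd \<Rightarrow> nat \<Rightarrow> rat" where
  "large_reward J v = of_int (scaled J (kreward J v))"

definition small :: "orientkd \<Rightarrow> nat \<Rightarrow> nat \<times> rat" where
  "small J v = (small_size J v, 0)"

definition large :: "orientkd \<Rightarrow> nat \<Rightarrow> nat \<times> rat" where
  "large J v = (large_size J v, large_reward J v)"

definition corrko_of :: "orientkd \<Rightarrow> corrko" where
  "corrko_of J = \<lparr>nv = knv J, root = kroot J, dst = (\<lambda>u v. nat (scaled J (kdst J u v))),
     travel_budget = nat (scaled J (kbudget J)), proc_budget = 2 * total_size J + 1,
     jobs = (\<lambda>v. if v = kroot J then [((0, 0), 1)]
       else [(small J v, Fract (2 * int (knv J) - 1) (2 * int (knv J))),
             (large J v, Fract 1 (2 * int (knv J)))])\<rparr>"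

lemma corrko_of_simps [simp]:
  "nv (corrko_of J) = knv J" "root (corrko_of J) = kroot J"
  "proc_budget (corrko_of J) = 2 * total_size J + 1"
  by (simp_all add: corrko_of_def)

lemma of_nat_sum_list: "of_nat (\<Sum>x\<leftarrow>xs. f x) = (\<Sum>x\<leftarrow>xs. of_nat (f x))"
  by (induction xs) auto

lemma prod_list_pos: "(\<And>x. x \<in> set xs \<Longrightarrow> 0 < x) \<Longrightarrow> 0 < prod_list (xs :: int list)"
  by (induction xs) auto

lemma dvd_prod_list: "x \<in> set xs \<Longrightarrow> x dvd prod_list (xs :: int list)"
  by (induction xs) auto

lemma denominators_prod_pos: "0 < denominators_prod qs"
  unfolding denominators_prod_def by (rule prod_list_pos) (auto simp: quotient_of_denom_pos')

lemma dvd_denominators_prod: "q \<in> set qs \<Longrightarrow> snd (quotient_of q) dvd denominators_prod qs"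
  unfolding denominators_prod_def by (rule dvd_prod_list) auto

lemma scale_factor_pos: "0 < scale_factor J"
  unfolding scale_factor_def
  by (intro mult_pos_pos prod_list_pos) (auto simp: quotient_of_denom_pos' denominators_prod_pos)

lemma of_int_scaled:
  assumes "snd (quotient_of q) dvd scale_factor J"
  shows "of_int (scaled J q) = of_int (scale_factor J) * q"
proof -
  obtain a b where ab: "quotient_of q = (a, b)" by force
  then have q: "q = of_int a / of_int b" and "b > 0"
    using quotient_of_div quotient_of_denom_pos by blast+
  obtain k where k: "scale_factor J = b * k" using assms ab by auto
  have "of_int (scaled J q) = (of_int a * of_int k :: rat)"
    using k \<open>b > 0\<close> by (simp add: scaled_def ab)
  also have "\<dots> = of_int (scale_factor J) * q"
    using \<open>b > 0\<close> unfolding q k by simp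
  finally show ?thesis .
qed

lemma of_int_scaled_instance:
  shows "u < knv J \<Longrightarrow> v < knv J \<Longrightarrow> of_int (scaled J (kdst J u v)) = of_int (scale_factor J) * kdst J u v"
    and "of_int (scaled J (kbudget J)) = of_int (scale_factor J) * kbudget J"
    and "v < knv J \<Longrightarrow> of_int (scaled J (kreward J v)) = of_int (scale_factor J) * kreward J v"
    and "v < knv J \<Longrightarrow> of_int (scaled J (kweight J v)) = of_int (scale_factor J) * kweight J v"
    and "v < knv J \<Longrightarrow> of_int (scaled J (kdeadline J v)) = of_int (scale_factor J) * kdeadline J v"
proof -
  show "of_int (scaled J (kdst J u v)) = of_int (scale_factor J) * kdst J u v" if "u < knv J" "v < knv J"
  proof (rule of_int_scaled)
    have "snd (quotient_of (kdst J u v)) dvd denominators_prod (map (kdst J u) [0..<knv J])"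
      using that by (intro dvd_denominators_prod) auto
    also have "\<dots> dvd prod_list (map (\<lambda>u. denominators_prod (map (kdst J u) [0..<knv J])) [0..<knv J])"
      using that by (intro dvd_prod_list) auto
    also have "\<dots> dvd scale_factor J"
      by (simp add: scale_factor_def mult.assoc)
    finally show "snd (quotient_of (kdst J u v)) dvd scale_factor J" .
  qed
  show "of_int (scaled J (kbudget J)) = of_int (scale_factor J) * kbudget J"
    by (rule of_int_scaled) (simp add: scale_factor_def)
  have "denominators_prod (map (kreward J) [0..<knv J]) dvd scale_factor J"
    unfolding scale_factor_def by (metis dvd_triv_left dvd_triv_right dvd_mult2)
  then show "of_int (scaled J (kreward J v)) = of_int (scale_factor J) * kreward J v" if "v < knv J"
    using that by (intro of_int_scaled dvd_trans[OF dvd_denominators_prod]) auto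
  have "denominators_prod (map (kweight J) [0..<knv J]) dvd scale_factor J"
    unfolding scale_factor_def by (metis dvd_triv_left dvd_triv_right dvd_mult2)
  then show "of_int (scaled J (kweight J v)) = of_int (scale_factor J) * kweight J v" if "v < knv J"
    using that by (intro of_int_scaled dvd_trans[OF dvd_denominators_prod]) auto
  have "denominators_prod (map (kdeadline J) [0..<knv J]) dvd scale_factor J"
    unfolding scale_factor_def by (metis dvd_triv_left dvd_triv_right dvd_mult2)
  then show "of_int (scaled J (kdeadline J v)) = of_int (scale_factor J) * kdeadline J v" if "v < knv J"
    using that by (intro of_int_scaled dvd_trans[OF dvd_denominators_prod]) auto
qed

lemma scaled_nonneg:
  assumes "0 \<le> q" shows "0 \<le> scaled J q"
proof -
  obtain a b where ab: "quotient_of q = (a, b)" by force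
  then have "q = of_int a / of_int b" "0 < b"
    using quotient_of_div quotient_of_denom_pos by blast+
  then have "0 \<le> a" using assms by (simp add: zero_le_divide_iff)
  moreover have "0 \<le> scale_factor J div b"
    using \<open>0 < b\<close> scale_factor_pos[of J] by (simp add: pos_imp_zdiv_nonneg_iff)
  ultimately show ?thesis by (simp add: scaled_def ab)
qed

locale reduction =
  fixes J :: orientkd
  assumes inst: "orientkd_instance J"
begin

abbreviation "I \<equiv> corrko_of J"

lemma root_less: "kroot J < knv J"
  using inst by (simp add: orientkd_instance_def)

lemma nonneg: "v < knv J \<Longrightarrow> 0 \<le> kreward J v" "v < knv J \<Longrightarrow> 0 \<le> kweight J v" "0 \<le> kbudget J"
  using inst by (auto simp: orientkd_instance_def)

lemma metric: "Metric_space {..<knv J} (\<lambda>u v. real_of_rat (kdst J u v))"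
  using inst by (simp add: orientkd_instance_def)

lemma kdst_nonneg: "0 \<le> kdst J u v"
  using Metric_space.nonneg[OF metric, of u v] by simp

lemma large_reward_eq: "v < knv J \<Longrightarrow> large_reward J v = of_int (scale_factor J) * kreward J v"
  by (simp add: large_reward_def of_int_scaled_instance)

lemma large_reward_nonneg: "v < knv J \<Longrightarrow> 0 \<le> large_reward J v"
  using scale_factor_pos[of J] nonneg by (simp add: large_reward_eq)

lemma int_small_size:
  "v < knv J \<Longrightarrow> v \<noteq> kroot J \<Longrightarrow> int (small_size J v) = scaled J (kweight J v)"
  using nonneg by (simp add: small_size_def scaled_nonneg)

lemma sum_small_size_le:
  assumes "distinct vs" shows "(\<Sum>v\<leftarrow>vs. small_size J v) \<le> total_size J"
proof -
  have "(\<Sum>v\<leftarrow>vs. small_size J v) = (\<Sum>v\<in>set vs. small_size J v)"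
    using assms by (simp add: sum_list_distinct_conv_sum_set)
  also have "\<dots> = (\<Sum>v\<in>set vs \<inter> {..<knv J}. small_size J v)"
    by (rule sum.mono_neutral_right) (auto simp: small_size_def)
  also have "\<dots> \<le> total_size J"
    unfolding total_size_def by (rule sum_mono2) auto
  finally show ?thesis .
qed

lemma int_large_size: "int (large_size J v) = int (2 * total_size J + 1) - slack J v + int (small_size J v)"
  and large_size_greater: "total_size J + small_size J v < large_size J v"
  by (auto simp: large_size_def slack_def)

lemma small_neq_large: "small J v \<noteq> large J v"
  using large_size_greater[of v] by (auto simp: small_def large_def)

lemma large_prob:
  "real_of_rat (Fract 1 (2 * int (knv J))) = 1 / (2 * real (knv J))"
  "real_of_rat (Fract (2 * int (knv J) - 1) (2 * int (knv J))) = 1 - 1 / (2 * real (knv J))"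
  using root_less by (simp_all add: of_rat_rat diff_divide_distrib)

lemma job_list_wf: "pmf_of_list_wf (job_list I v)"
proof -
  have "1 / (2 * real (knv J)) \<le> 1" using root_less by (simp add: field_simps)
  then show ?thesis
    by (auto simp: job_list_def corrko_of_def large_prob simp del: of_rat_le_0_iff zero_le_of_rat_iff
        intro!: pmf_of_list_wfI)
qed

lemma job_pmf_root: "job_pmf I (kroot J) = return_pmf (0, 0)"
proof (rule pmf_eqI)
  show "pmf (job_pmf I (kroot J)) x = pmf (return_pmf (0, 0)) x" for x
    using pmf_pmf_of_list[OF job_list_wf[of "kroot J"], of x]
    by (auto simp: job_pmf_def job_list_def corrko_of_def pmf_return)
qed

lemma pmf_job:
  assumes "v \<noteq> kroot J"
  shows "pmf (job_pmf I v) (small J v) = 1 - 1 / (2 * real (knv J))"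
    and "pmf (job_pmf I v) (large J v) = 1 / (2 * real (knv J))"
  using assms pmf_pmf_of_list[OF job_list_wf[of v]] small_neq_large[of v]
  by (auto simp: job_pmf_def job_list_def corrko_of_def large_prob)

lemma set_job_pmf:
  assumes "v \<noteq> kroot J"
  shows "set_pmf (job_pmf I v) \<subseteq> {small J v, large J v}"
  using assms set_pmf_of_list[OF job_list_wf[of v]]
  by (auto simp: job_pmf_def job_list_def corrko_of_def)

lemma of_nat_dst:
  assumes "u < knv J" "v < knv J"
  shows "rat_of_nat (dst I u v) = of_int (scale_factor J) * kdst J u v"
  using scaled_nonneg[OF kdst_nonneg] of_int_scaled_instance(1)[OF assms]
  by (simp add: corrko_of_def)

lemma corrko_instance: "corrko_instance I"
proof -
  interpret Metric_space "{..<knv J}" "\<lambda>u v. real_of_rat (kdst J u v)" by (rule metric)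
  define s where "s = real_of_int (scale_factor J)"
  have s: "s > 0" using scale_factor_pos[of J] by (simp add: s_def)
  have d: "real (dst I u v) = s * real_of_rat (kdst J u v)" if "u < knv J" "v < knv J" for u v
    using arg_cong[OF of_nat_dst[OF that], of real_of_rat] by (simp add: of_rat_mult s_def)
  have "Metric_space {..<knv J} (\<lambda>u v. real (dst I u v))"
  proof
    show "real (dst I u v) = real (dst I v u)" for u v
      using commute[of u v] by (simp add: corrko_of_def)
    show "real (dst I u v) = 0 \<longleftrightarrow> u = v" if "u \<in> {..<knv J}" "v \<in> {..<knv J}" for u v
      using that d s zero by auto
    show "real (dst I u w) \<le> real (dst I u v) + real (dst I v w)"
      if "u \<in> {..<knv J}" "v \<in> {..<knv J}" "w \<in> {..<knv J}" for u v w
      using that d s triangle[of u v w] by (simp flip: distrib_left)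
  qed auto
  moreover have "\<forall>v<knv J. \<forall>((s, r), q)\<in>set (jobs I v). r \<ge> 0"
    using large_reward_nonneg by (auto simp: corrko_of_def small_def large_def)
  ultimately show ?thesis
    using root_less job_list_wf job_pmf_root by (simp add: corrko_instance_def)
qed

lemma outcome_cases:
  assumes "\<omega> \<in> set_pmf (outcomes I)" "v < knv J" "v \<noteq> kroot J"
  shows "\<omega> v = small J v \<or> \<omega> v = large J v"
proof -
  have "\<omega> v \<in> set_pmf (job_pmf I v)"
    using assms by (simp add: outcomes_def set_Pi_pmf PiE_dflt_def)
  then show ?thesis using set_job_pmf[OF assms(3)] by blast
qed

lemma outcome_reward_nonneg:
  assumes "\<omega> \<in> set_pmf (outcomes I)" shows "0 \<le> snd (\<omega> v)"
proof (cases "v < knv J \<and> v \<noteq> kroot J")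
  case True
  with outcome_cases[OF assms, of v] show ?thesis
    using large_reward_nonneg[of v] by (elim conjE disjE) (auto simp: small_def large_def)
next
  case False
  moreover have "if v < knv J then \<omega> v \<in> set_pmf (job_pmf I v) else \<omega> v = (0, 0)"
    using assms by (simp add: outcomes_def set_Pi_pmf PiE_dflt_def)
  ultimately have "\<omega> v = (0, 0)"
    by (cases "v < knv J") (simp_all add: job_pmf_root)
  then show ?thesis by simp
qed

lemma pmf_job_small: "v < knv J \<Longrightarrow> pmf (job_pmf I v) (small J v) =
    (if v = kroot J then 1 else 1 - 1 / (2 * real (knv J)))"
  using pmf_job(1)[of v] by (auto simp: job_pmf_root pmf_return small_def small_size_def)

lemma small_outcome: "small J \<in> set_pmf (outcomes I)"
proof -
  have "small J v \<in> set_pmf (job_pmf I v)" if "v < knv J" for v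
    using that pmf_job_small[OF that] by (auto simp: set_pmf_iff field_simps)
  then show ?thesis by (auto simp: outcomes_def set_Pi_pmf PiE_dflt_def small_def small_size_def)
qed

lemma pmf_one_large:
  assumes "v < knv J" "v \<noteq> kroot J"
  shows "pmf (outcomes I) ((small J)(v := large J v)) \<ge> 1 / (4 * real (knv J))"
proof -
  define p where "p = 1 / (2 * real (knv J))"
  define n where "n = knv J"
  have n: "n \<ge> 1" using root_less by (simp add: n_def)
  have p: "0 \<le> p" "p \<le> 1" using n by (auto simp: p_def n_def)
  have "pmf (outcomes I) ((small J)(v := large J v))
    = (\<Prod>u<knv J. pmf (job_pmf I u) (((small J)(v := large J v)) u))"
    using assms unfolding outcomes_def by (subst pmf_Pi') (auto simp: small_def small_size_def)
  also have "\<dots> = pmf (job_pmf I v) (large J v) * (\<Prod>u\<in>{..<knv J} - {v}. pmf (job_pmf I u) (small J u))"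
    using assms by (subst prod.remove[of _ v]) (auto intro!: prod.cong)
  also have "\<dots> = p * (\<Prod>u\<in>{..<knv J} - {v}. pmf (job_pmf I u) (small J u))"
    using assms by (simp add: pmf_job p_def)
  also have "\<dots> \<ge> p * (\<Prod>u\<in>{..<knv J} - {v}. 1 - p)"
  proof (intro mult_left_mono prod_mono conjI p)
    show "1 - p \<le> pmf (job_pmf I u) (small J u)" if "u \<in> {..<knv J} - {v}" for u
      using that p pmf_job_small[of u] by (auto simp: p_def)
  qed (use p in auto)
  also have "p * (\<Prod>u\<in>{..<knv J} - {v}. 1 - p) = p * (1 - p) ^ (n - 1)"
    using assms by (simp add: n_def)
  finally have *: "p * (1 - p) ^ (n - 1) \<le> pmf (outcomes I) ((small J)(v := large J v))" .
  have "1 / 2 \<le> 1 - real (n - 1) * p"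
    using n by (simp add: p_def n_def field_simps of_nat_diff)
  also have "\<dots> \<le> (1 - p) ^ (n - 1)"
    using Bernoulli_inequality[of "- p" "n - 1"] p by simp
  finally have "p * (1 / 2) \<le> p * (1 - p) ^ (n - 1)" using p by (intro mult_left_mono)
  then show ?thesis using * by (simp add: p_def)
qed

lemma prob_large:
  assumes "v < knv J" "v \<noteq> kroot J"
  shows "measure_pmf.prob (outcomes I) {\<omega>. \<omega> v = large J v} = 1 / (2 * real (knv J))"
proof -
  have "measure_pmf.prob (outcomes I) {\<omega>. \<omega> v = large J v} = pmf (map_pmf (\<lambda>\<omega>. \<omega> v) (outcomes I)) (large J v)"
    unfolding pmf_map by (rule arg_cong[where f = "measure_pmf.prob _"]) auto
  also have "\<dots> = pmf (job_pmf I v) (large J v)"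
    using assms by (simp add: outcomes_def Pi_pmf_component)
  finally show ?thesis using assms by (simp add: pmf_job)
qed

lemma finite_outcomes: "finite (set_pmf (outcomes I))"
  unfolding outcomes_def set_Pi_pmf[OF finite_lessThan]
  by (intro finite_PiE_dflt) (auto simp: job_pmf_def finite_set_pmf_of_list[OF job_list_wf])

end

section \<open>Analysis of policies\<close>

definition history_after :: "corrko \<Rightarrow> policy \<Rightarrow> (nat \<Rightarrow> nat \<times> rat) \<Rightarrow> nat \<Rightarrow> history" where
  "history_after I pol \<omega> k = (policy_step I pol \<omega> ^^ k) []"

lemma history_after_0 [simp]: "history_after I pol \<omega> 0 = []"
  by (simp add: history_after_def)

lemma history_after_Suc:
  "history_after I pol \<omega> (Suc k) = policy_step I pol \<omega> (history_after I pol \<omega> k)"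
  by (simp add: history_after_def)

lemma run_eq_history_after: "run I pol \<omega> = history_after I pol \<omega> (nv I)"
  by (simp add: run_def history_after_def)

lemma history_after_prefix: "k \<le> m \<Longrightarrow> prefix (history_after I pol \<omega> k) (history_after I pol \<omega> m)"
  by (induction m rule: dec_induct)
    (auto simp: history_after_Suc policy_step_def split: option.split intro: prefix_order.trans)

lemma history_after_values: "(v, x) \<in> set (history_after I pol \<omega> k) \<Longrightarrow> x = \<omega> v"
  by (induction k) (auto simp: history_after_Suc policy_step_def split: option.splits if_splits)

lemma used_Nil [simp]: "used [] = 0"
  and used_snoc [simp]: "used (h @ [(v, x)]) = used h + fst x"
  and used_append: "used (h @ h') = used h + used h'"
  and used_Cons [simp]: "used ((v, x) # h) = fst x + used h"
  by (auto simp: used_def split: prod.split)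

lemma collected_Nil [simp]: "collected I [] = 0"
  by (simp add: collected_def)

lemma collected_snoc:
  "collected I (h @ [(v, x)]) = collected I h + (if used h + fst x \<le> proc_budget I then snd x else 0)"
proof -
  have "(\<Sum>i<length h. if used (take (Suc i) (h @ [(v, x)])) \<le> proc_budget I then snd (snd ((h @ [(v, x)]) ! i)) else 0)
      = collected I h"
    unfolding collected_def by (intro sum.cong) (auto simp: nth_append)
  then show ?thesis by (simp add: collected_def)
qed

lemma collected_append_mono:
  "(\<And>v x. (v, x) \<in> set h' \<Longrightarrow> 0 \<le> snd x) \<Longrightarrow> collected I h \<le> collected I (h @ h')"
proof (induction h' rule: rev_induct)
  case (snoc y h')
  obtain v x where y: "y = (v, x)" by (cases y)
  have "collected I h \<le> collected I (h @ h')"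
  proof (rule snoc.IH)
    show "0 \<le> snd x" if "(v, x) \<in> set h'" for v x using snoc.prems[of v x] that by simp
  qed
  also have "\<dots> \<le> collected I ((h @ h') @ [(v, x)])"
    unfolding collected_snoc using snoc.prems[of v x] y by simp
  finally show ?case by (simp add: y)
qed auto

lemma visited_feasible:
  assumes "feasible_policy I pol" "\<omega> \<in> set_pmf (outcomes I)" "k \<le> nv I"
  shows "distinct (visited I (history_after I pol \<omega> k))"
    and "set (visited I (history_after I pol \<omega> k)) \<subseteq> {..<nv I}"
proof -
  obtain h where "run I pol \<omega> = history_after I pol \<omega> k @ h"
    using history_after_prefix[OF assms(3), of I pol \<omega>] unfolding run_eq_history_after prefix_def by blast
  moreover have "distinct (visited I (run I pol \<omega>))" "set (visited I (run I pol \<omega>)) \<subseteq> {..<nv I}"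
    using assms unfolding feasible_policy_def Let_def by auto
  ultimately show "distinct (visited I (history_after I pol \<omega> k))"
    "set (visited I (history_after I pol \<omega> k)) \<subseteq> {..<nv I}"
    by (auto simp: visited_def)
qed

text \<open>Vertices that are dropped still count towards the deadlines of later ones, so that the kept
  vertices are those that meet their deadline along the whole history, after prior weight \<open>s\<close>.\<close>

fun timely :: "orientkd \<Rightarrow> int \<Rightarrow> history \<Rightarrow> nat list" where
  "timely J s [] = []"
| "timely J s ((v, x) # h) =
     (if s + int (fst x) \<le> scaled J (kdeadline J v) then v # timely J (s + int (fst x)) h
      else timely J (s + int (fst x)) h)"

lemma timely_append: "timely J s (h @ h') = timely J s h @ timely J (s + int (used h)) h'"
  by (induction J s h rule: timely.induct) (auto simp: add.assoc)

lemma subseq_timely: "subseq (timely J s h) (map fst h)"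
  by (induction J s h rule: timely.induct) auto

context reduction
begin

definition timely_run :: "policy \<Rightarrow> nat list" where
  "timely_run pol = timely J (scaled J (kweight J (kroot J))) (run I pol (small J))"

lemma timely_run_subset:
  assumes "feasible_policy I pol"
  shows "set (timely_run pol) \<subseteq> {..<knv J} - {kroot J}" "distinct (timely_run pol)"
proof -
  define P where "P = map fst (run I pol (small J))"
  have *: "subseq (timely_run pol) P"
    by (simp add: timely_run_def P_def subseq_timely)
  have "distinct (visited I (run I pol (small J)))" "set (visited I (run I pol (small J))) \<subseteq> {..<knv J}"
    using visited_feasible[OF assms small_outcome, of "nv I"] by (auto simp: run_eq_history_after)
  then have "set P \<subseteq> {..<knv J} - {kroot J}" "distinct P"
    unfolding visited_def P_def[symmetric] by auto
  moreover obtain N where "timely_run pol = nths P N" using * unfolding subseq_conv_nths by blast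
  ultimately show "set (timely_run pol) \<subseteq> {..<knv J} - {kroot J}" "distinct (timely_run pol)"
    using set_nths_subset[of P N] distinct_nthsI[of P N] by simp_all
qed

text \<open>Until the first large job occurs, the run agrees with the run in which all jobs are small;
  after it, no further large job fits.\<close>

lemma collected_le:
  assumes feas: "feasible_policy I pol" and \<omega>: "\<omega> \<in> set_pmf (outcomes I)"
  shows "collected I (run I pol \<omega>) \<le>
    (\<Sum>v\<in>set (timely_run pol). if \<omega> v = large J v then large_reward J v else 0)" (is "_ \<le> ?c")
proof -
  have nonneg: "0 \<le> (if \<omega> v = large J v then large_reward J v else 0)" if "v \<in> set (timely_run pol)" for v
    using timely_run_subset(1)[OF feas] that large_reward_nonneg by auto
  then have c: "0 \<le> ?c" by (intro sum_nonneg)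
  have inv: "history_after I pol \<omega> k = history_after I pol (small J) k \<and> collected I (history_after I pol \<omega> k) = 0 \<or>
      used (history_after I pol \<omega> k) > total_size J \<and> collected I (history_after I pol \<omega> k) \<le> ?c"
    if "k \<le> knv J" for k
    using that
  proof (induction k)
    case (Suc k)
    define h where "h = history_after I pol \<omega> k"
    define h0 where "h0 = history_after I pol (small J) k"
    have Suc_eq: "history_after I pol \<omega> (Suc k) = policy_step I pol \<omega> h"
      "history_after I pol (small J) (Suc k) = policy_step I pol (small J) h0"
      by (simp_all add: h_def h0_def history_after_Suc)
    have IH: "h = h0 \<and> collected I h = 0 \<or> used h > total_size J \<and> collected I h \<le> ?c"
      using Suc by (simp add: h_def h0_def)
    show ?case
    proof (cases "used h \<le> proc_budget I \<and> pol h \<noteq> None")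
      case False
      then show ?thesis using IH unfolding Suc_eq by (auto simp: policy_step_def)
    next
      case True
      then obtain v where v: "pol h = Some v" by auto
      have h': "policy_step I pol \<omega> h = h @ [(v, \<omega> v)]"
        using True v by (simp add: policy_step_def)
      have "distinct (visited I (h @ [(v, \<omega> v)]))" "set (visited I (h @ [(v, \<omega> v)])) \<subseteq> {..<knv J}"
        using visited_feasible[OF feas \<omega>, of "Suc k"] Suc.prems by (auto simp: Suc_eq h')
      then have v': "v < knv J" "v \<noteq> kroot J" by (auto simp: visited_def)
      consider "\<omega> v = small J v" | "\<omega> v = large J v" "h = h0" "collected I h = 0"
        | "\<omega> v = large J v" "used h > total_size J" "collected I h \<le> ?c"
        using outcome_cases[OF \<omega> v'] IH by blast
      then show ?thesis
      proof cases
        case 1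
        then have "h = h0 \<Longrightarrow> policy_step I pol (small J) h0 = h @ [(v, \<omega> v)]"
          using True v by (simp add: policy_step_def)
        moreover have "collected I (h @ [(v, \<omega> v)]) = collected I h"
          using 1 by (simp add: collected_snoc small_def)
        ultimately show ?thesis using IH unfolding Suc_eq h' by auto
      next
        case 2
        have "collected I (h @ [(v, \<omega> v)]) \<le> ?c"
        proof (cases "used h + large_size J v \<le> proc_budget I")
          case fits: True
          have "int (used h) + int (small_size J v) \<le> slack J v"
            using fits int_large_size[of v] by simp
          then have "v \<in> set (timely J (scaled J (kweight J (kroot J))) (h0 @ [(v, small J v)]))"
            using 2 by (simp add: timely_append slack_def small_def)
          moreover have "policy_step I pol (small J) h0 = h0 @ [(v, small J v)]"
            using True v 2 by (simp add: policy_step_def)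
          then have "prefix (h0 @ [(v, small J v)]) (run I pol (small J))"
            using history_after_prefix[OF Suc.prems, of I pol "small J"] Suc_eq
            by (simp add: run_eq_history_after)
          ultimately have "v \<in> set (timely_run pol)"
            by (auto simp: timely_run_def prefix_def timely_append)
          then have "large_reward J v \<le> ?c"
            using member_le_sum[of v "set (timely_run pol)" "\<lambda>v. if \<omega> v = large J v then large_reward J v else 0"]
              nonneg 2 by auto
          then show ?thesis using 2 fits by (simp add: collected_snoc large_def)
        next
          case False
          then show ?thesis using 2 c by (simp add: collected_snoc large_def)
        qed
        moreover have "used (h @ [(v, \<omega> v)]) > total_size J"
          using 2 large_size_greater[of v] by (simp add: large_def)
        ultimately show ?thesis unfolding Suc_eq h' by blast
      next
        case 3
        have "collected I (h @ [(v, \<omega> v)]) = collected I h"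
          using 3 large_size_greater[of v] by (simp add: collected_snoc large_def)
        then show ?thesis using 3 unfolding Suc_eq h' by simp
      qed
    qed
  qed auto
  show ?thesis using inv[of "knv J"] c by (auto simp: run_eq_history_after)
qed

lemma expected_reward_le:
  assumes "feasible_policy I pol"
  shows "expected_reward I pol \<le>
    real_of_rat (\<Sum>v\<in>set (timely_run pol). large_reward J v) / (2 * real (knv J))"
proof -
  note [simp] = integrable_measure_pmf_finite[OF finite_outcomes]
  define c where "c \<omega> = (\<Sum>v\<in>set (timely_run pol).
    real_of_rat (large_reward J v) * indicator {\<omega>. \<omega> v = large J v} \<omega>)" for \<omega>
  have "real_of_rat (collected I (run I pol \<omega>)) \<le> c \<omega>" if "\<omega> \<in> set_pmf (outcomes I)" for \<omega>
  proof -
    have "c \<omega> = real_of_rat (\<Sum>v\<in>set (timely_run pol). if \<omega> v = large J v then large_reward J v else 0)"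
      unfolding c_def of_rat_sum by (intro sum.cong) auto
    then show ?thesis using collected_le[OF assms that] by (simp add: of_rat_less_eq)
  qed
  then have "expected_reward I pol \<le> measure_pmf.expectation (outcomes I) c"
    unfolding expected_reward_def by (intro integral_mono_AE) (auto simp: AE_measure_pmf_iff)
  also have "\<dots> = (\<Sum>v\<in>set (timely_run pol). real_of_rat (large_reward J v) *
      measure_pmf.prob (outcomes I) {\<omega>. \<omega> v = large J v})"
    unfolding c_def by (subst Bochner_Integration.integral_sum) simp_all
  also have "\<dots> = (\<Sum>v\<in>set (timely_run pol). real_of_rat (large_reward J v) / (2 * real (knv J)))"
  proof (intro sum.cong refl)
    fix v assume "v \<in> set (timely_run pol)"
    then have "v < knv J" "v \<noteq> kroot J" using timely_run_subset(1)[OF assms] by auto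
    then show "real_of_rat (large_reward J v) * measure_pmf.prob (outcomes I) {\<omega>. \<omega> v = large J v} =
        real_of_rat (large_reward J v) / (2 * real (knv J))"
      using prob_large by simp
  qed
  also have "\<dots> = real_of_rat (\<Sum>v\<in>set (timely_run pol). large_reward J v) / (2 * real (knv J))"
    by (simp add: of_rat_sum sum_divide_distrib)
  finally show ?thesis .
qed

lemma history_after_nonadaptive:
  "\<exists>j\<le>k. history_after I (nonadaptive vs) \<omega> k = map (\<lambda>v. (v, \<omega> v)) (take j vs)"
proof (induction k)
  case (Suc k)
  then obtain j where j: "j \<le> k" "history_after I (nonadaptive vs) \<omega> k = map (\<lambda>v. (v, \<omega> v)) (take j vs)"
    by blast
  show ?case
  proof (cases "j < length vs \<and> used (map (\<lambda>v. (v, \<omega> v)) (take j vs)) \<le> proc_budget I")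
    case True
    then have "history_after I (nonadaptive vs) \<omega> (Suc k) = map (\<lambda>v. (v, \<omega> v)) (take (Suc j) vs)"
      using j by (simp add: history_after_Suc policy_step_def nonadaptive_def take_Suc_conv_app_nth min_def)
    then show ?thesis using j by (intro exI[of _ "Suc j"]) auto
  next
    case False
    then have "history_after I (nonadaptive vs) \<omega> (Suc k) = map (\<lambda>v. (v, \<omega> v)) (take j vs)"
      using j by (auto simp: history_after_Suc policy_step_def nonadaptive_def)
    then show ?thesis using j by (intro exI[of _ j]) auto
  qed
qed auto

lemma history_after_nonadaptive_eq:
  assumes "k \<le> length vs" "\<And>j. j < k \<Longrightarrow> used (map (\<lambda>v. (v, \<omega> v)) (take j vs)) \<le> proc_budget I"
  shows "history_after I (nonadaptive vs) \<omega> k = map (\<lambda>v. (v, \<omega> v)) (take k vs)"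
  using assms
proof (induction k)
  case (Suc k)
  then show ?case
    by (auto simp: history_after_Suc policy_step_def nonadaptive_def take_Suc_conv_app_nth)
qed auto

lemma collected_nonadaptive_ge:
  assumes "distinct (us @ v # ws)" "set (us @ v # ws) \<subseteq> {..<knv J} - {kroot J}"
    and fits: "(\<Sum>u\<leftarrow>us. int (small_size J u)) + int (small_size J v) \<le> slack J v"
  shows "large_reward J v \<le>
    collected I (run I (nonadaptive (us @ v # ws)) ((small J)(v := large J v)))"
proof -
  define \<omega> where "\<omega> = (small J)(v := large J v)"
  have used_le: "used (map (\<lambda>v. (v, \<omega> v)) ys) = (\<Sum>u\<leftarrow>ys. small_size J u)" if "v \<notin> set ys" for ys
    using that by (induction ys) (auto simp: \<omega>_def small_def)
  have k: "Suc (length us) \<le> knv J"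
  proof -
    have "card (set (us @ [v])) \<le> card {..<knv J}" using assms by (intro card_mono) auto
    then show ?thesis using assms by (simp add: distinct_card)
  qed
  have "history_after I (nonadaptive (us @ v # ws)) \<omega> (Suc (length us)) =
      map (\<lambda>v. (v, \<omega> v)) (take (Suc (length us)) (us @ v # ws))"
  proof (rule history_after_nonadaptive_eq)
    fix j assume "j < Suc (length us)"
    then have j: "take j (us @ v # ws) = take j us" by simp
    have "v \<notin> set (take j us)" using assms(1) by (auto dest: in_set_takeD)
    then have "used (map (\<lambda>v. (v, \<omega> v)) (take j us)) = (\<Sum>u\<leftarrow>take j us. small_size J u)"
      by (rule used_le)
    also have "\<dots> \<le> total_size J" using assms(1) by (intro sum_small_size_le) auto
    finally show "used (map (\<lambda>v. (v, \<omega> v)) (take j (us @ v # ws))) \<le> proc_budget I"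
      unfolding j by simp
  qed simp
  then have h: "history_after I (nonadaptive (us @ v # ws)) \<omega> (Suc (length us)) =
      map (\<lambda>v. (v, \<omega> v)) us @ [(v, large J v)]"
    by (simp add: \<omega>_def)
  obtain h' where h': "run I (nonadaptive (us @ v # ws)) \<omega> = (map (\<lambda>v. (v, \<omega> v)) us @ [(v, large J v)]) @ h'"
    using history_after_prefix[OF k, of I "nonadaptive (us @ v # ws)" \<omega>]
    by (auto simp: h run_eq_history_after prefix_def)
  have val: "0 \<le> snd x" if "(u, x) \<in> set (run I (nonadaptive (us @ v # ws)) \<omega>)" for u x
    using history_after_values[OF that[unfolded run_eq_history_after]] assms(2) large_reward_nonneg
    by (auto simp: \<omega>_def small_def large_def)
  have "used (map (\<lambda>v. (v, \<omega> v)) us) = (\<Sum>u\<leftarrow>us. small_size J u)"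
    using assms(1) by (intro used_le) auto
  then have "int (used (map (\<lambda>v. (v, \<omega> v)) us)) = (\<Sum>u\<leftarrow>us. int (small_size J u))"
    by (simp add: of_nat_sum_list)
  then have "used (map (\<lambda>v. (v, \<omega> v)) us) + large_size J v \<le> proc_budget I"
    using fits int_large_size[of v] by simp
  moreover have "collected I [] \<le> collected I ([] @ map (\<lambda>v. (v, \<omega> v)) us)"
    using val unfolding h' by (intro collected_append_mono) auto
  ultimately have "large_reward J v \<le> collected I (map (\<lambda>v. (v, \<omega> v)) us @ [(v, large J v)])"
    by (simp add: collected_snoc) (simp add: large_def)
  also have "\<dots> \<le> collected I (run I (nonadaptive (us @ v # ws)) \<omega>)"
    using val unfolding h' by (intro collected_append_mono) auto
  finally show ?thesis unfolding \<omega>_def .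
qed

lemma expected_reward_nonadaptive_ge:
  assumes "distinct vs" "set vs \<subseteq> {..<knv J} - {kroot J}"
    and fits: "\<And>us v ws. vs = us @ v # ws \<Longrightarrow>
      (\<Sum>u\<leftarrow>us. int (small_size J u)) + int (small_size J v) \<le> slack J v"
  shows "real_of_rat (\<Sum>v\<in>set vs. large_reward J v) / (4 * real (knv J))
    \<le> expected_reward I (nonadaptive vs)"
proof -
  note [simp] = integrable_measure_pmf_finite[OF finite_outcomes]
  define one where "one v = (small J)(v := large J v)" for v
  have one_inj: "u = v" if "one u = one v" for u v
    using fun_cong[OF that, of u] small_neq_large[of u] by (auto simp: one_def split: if_splits)
  define c where "c \<omega> = (\<Sum>v\<in>set vs. real_of_rat (large_reward J v) * indicator {one v} \<omega>)" for \<omega>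
  have le: "c \<omega> \<le> real_of_rat (collected I (run I (nonadaptive vs) \<omega>))" if \<omega>: "\<omega> \<in> set_pmf (outcomes I)" for \<omega>
  proof (cases "\<exists>v\<in>set vs. \<omega> = one v")
    case True
    then obtain v where v: "v \<in> set vs" "\<omega> = one v" by blast
    have "c \<omega> = (\<Sum>u\<in>set vs. if u = v then real_of_rat (large_reward J u) else 0)"
      unfolding c_def v(2) by (intro sum.cong) (auto dest: one_inj split: split_indicator)
    also have "\<dots> = real_of_rat (large_reward J v)" using v by simp
    also obtain us ws where vs: "vs = us @ v # ws" using v(1) by (meson split_list)
    have "large_reward J v \<le> collected I (run I (nonadaptive vs) \<omega>)"
      using collected_nonadaptive_ge[of us v ws] assms fits[OF vs] by (simp add: vs v(2) one_def)
    finally show ?thesis by (simp add: of_rat_less_eq)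
  next
    case False
    then have "c \<omega> = 0" unfolding c_def by (intro sum.neutral) auto
    moreover have "collected I [] \<le> collected I ([] @ run I (nonadaptive vs) \<omega>)"
    proof (rule collected_append_mono)
      fix v x assume "(v, x) \<in> set (run I (nonadaptive vs) \<omega>)"
      then show "0 \<le> snd x"
        using history_after_values outcome_reward_nonneg[OF \<omega>] unfolding run_eq_history_after by metis
    qed
    ultimately show ?thesis by simp
  qed
  have "real_of_rat (\<Sum>v\<in>set vs. large_reward J v) / (4 * real (knv J))
    = (\<Sum>v\<in>set vs. real_of_rat (large_reward J v) * (1 / (4 * real (knv J))))"
    by (simp add: of_rat_sum sum_divide_distrib)
  also have "\<dots> \<le> (\<Sum>v\<in>set vs. real_of_rat (large_reward J v) * pmf (outcomes I) (one v))"
    using assms(2) pmf_one_large large_reward_nonneg unfolding one_def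
    by (intro sum_mono mult_left_mono) auto
  also have "\<dots> = measure_pmf.expectation (outcomes I) c"
    unfolding c_def by (subst Bochner_Integration.integral_sum) (simp_all add: measure_pmf_single)
  also have "\<dots> \<le> expected_reward I (nonadaptive vs)"
    unfolding expected_reward_def using le by (intro integral_mono_AE) (auto simp: AE_measure_pmf_iff)
  finally show ?thesis .
qed

end

section \<open>Paths\<close>

lemma path_length_simps [simp]:
  "path_length d [] = 0" "path_length d [u] = 0"
  "path_length d (u # v # P) = d u v + path_length d (v # P)"
  by (simp_all add: path_length_def sum.lessThan_Suc_shift del: sum.lessThan_Suc)

lemma of_nat_path_length:
  fixes d' :: "nat \<Rightarrow> nat \<Rightarrow> 'a::comm_semiring_1"
  assumes "\<And>u v. u \<in> set P \<Longrightarrow> v \<in> set P \<Longrightarrow> of_nat (d u v) = c * d' u v"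
  shows "of_nat (path_length d P) = c * path_length d' P"
  using assms
  by (induction P rule: induct_list012) (auto simp: distrib_left)

lemma path_length_take_le: "path_length d (take k P) \<le> (path_length d P :: nat)"
proof -
  have "path_length d (take k P) = (\<Sum>i<length (take k P) - 1. d (P ! i) (P ! Suc i))"
    unfolding path_length_def by (intro sum.cong) auto
  also have "\<dots> \<le> path_length d P"
    unfolding path_length_def by (rule sum_mono2) auto
  finally show ?thesis .
qed

lemma path_length_subseq_le:
  fixes d :: "nat \<Rightarrow> nat \<Rightarrow> 'a::linordered_idom"
  assumes "subseq Q P" "set (u # P) \<subseteq> V" "\<And>u v. 0 \<le> d u v"
    "\<And>u v w. u \<in> V \<Longrightarrow> v \<in> V \<Longrightarrow> w \<in> V \<Longrightarrow> d u w \<le> d u v + d v w"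
  shows "path_length d (u # Q) \<le> path_length d (u # P)"
  using assms(1,2)
proof (induction P arbitrary: Q u rule: list.induct)
  case (Cons v P)
  have nonneg: "0 \<le> path_length d P" for P
    unfolding path_length_def by (intro sum_nonneg assms(3))
  show ?case
  proof (cases Q)
    case Nil
    then show ?thesis using nonneg[of "u # v # P"] by (simp del: path_length_simps(3))
  next
    case Q: (Cons w Q')
    show ?thesis
    proof (cases "w = v")
      case True
      then show ?thesis using Q Cons.prems Cons.IH[of Q' v] by auto
    next
      case False
      then have sub: "subseq (w # Q') P" using Q Cons.prems by (auto simp: subseq_Cons2_neq)
      then obtain N where "w # Q' = nths P N" unfolding subseq_conv_nths by blast
      then have "w \<in> set P" using set_nths_subset[of P N] by (metis list.set_intros(1) subsetD)
      then have "w \<in> V" using Cons.prems by auto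
      then have "d u w \<le> d u v + d v w" using Cons.prems by (intro assms(4)) auto
      moreover have "path_length d (v # w # Q') \<le> path_length d (v # P)"
        using sub Cons.prems by (intro Cons.IH) auto
      ultimately show ?thesis unfolding Q by simp
    qed
  qed
qed (auto dest: list_emb_Nil2)

fun meets :: "('a \<Rightarrow> 'b::linordered_idom) \<Rightarrow> ('a \<Rightarrow> 'b) \<Rightarrow> 'b \<Rightarrow> 'a list \<Rightarrow> bool" where
  "meets w K s [] = True"
| "meets w K s (v # P) = (s + w v \<le> K v \<and> meets w K (s + w v) P)"

lemma meets_iff: "meets w K s P \<longleftrightarrow> (\<forall>i<length P. s + (\<Sum>j\<le>i. w (P ! j)) \<le> K (P ! i))"
  by (induction P arbitrary: s) (simp_all add: All_less_Suc2 sum.atMost_Suc_shift add.assoc del: sum.atMost_Suc)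

lemma meets_append:
  "meets w K s (P @ Q) \<longleftrightarrow> meets w K s P \<and> meets w K (s + (\<Sum>v\<leftarrow>P. w v)) Q"
  by (induction P arbitrary: s) (auto simp: add.assoc)

lemma meets_of_int:
  fixes w K :: "'a \<Rightarrow> rat"
  assumes "\<And>v. v \<in> set P \<Longrightarrow> of_int (w' v) = c * w v \<and> of_int (K' v) = c * K v"
    "of_int s' = c * s" "0 < c"
  shows "meets w' K' s' P \<longleftrightarrow> meets w K s P"
  using assms(1,2)
proof (induction P arbitrary: s s')
  case (Cons v P)
  have "of_int (s' + w' v) = c * (s + w v)" using Cons.prems by (simp add: distrib_left)
  moreover have "s' + w' v \<le> K' v \<longleftrightarrow> s + w v \<le> K v"
  proof -
    have "s' + w' v \<le> K' v \<longleftrightarrow> (of_int (s' + w' v) :: rat) \<le> of_int (K' v)" by (rule of_int_le_iff[symmetric])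
    also have "\<dots> \<longleftrightarrow> c * (s + w v) \<le> c * K v" using Cons.prems by (simp add: distrib_left)
    finally show ?thesis using assms(3) by simp
  qed
  ultimately show ?case using Cons.IH[of "s' + w' v" "s + w v"] Cons.prems(1) by simp
qed auto

lemma meets_timely:
  assumes "\<And>v x. (v, x) \<in> set h \<Longrightarrow> int (fst x) = w v" "s \<le> s'"
  shows "meets w (\<lambda>v. scaled J (kdeadline J v)) s (timely J s' h)"
  using assms
proof (induction J s' h arbitrary: s rule: timely.induct)
  case (2 J s' v x h)
  have w: "int (fst x) = w v" using "2.prems"(1)[of v x] by simp
  have h: "int (fst y) = w u" if "(u, y) \<in> set h" for u y
    using that by (intro "2.prems"(1)) simp
  have "0 \<le> w v" by (simp flip: w)
  show ?case
  proof (cases "s' + int (fst x) \<le> scaled J (kdeadline J v)")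
    case True
    then show ?thesis using "2.IH"(1)[OF True h, of "s + w v"] "2.prems"(2) by (simp add: w)
  next
    case False
    then show ?thesis using "2.IH"(2)[OF False h, of s] "2.prems"(2) \<open>0 \<le> w v\<close> by (simp add: w)
  qed
qed auto

context reduction
begin

lemma path_length_dst:
  assumes "set P \<subseteq> {..<knv J}"
  shows "path_length (dst I) P \<le> travel_budget I \<longleftrightarrow> path_length (kdst J) P \<le> kbudget J"
proof -
  have b: "rat_of_nat (travel_budget I) = of_int (scale_factor J) * kbudget J"
    using scaled_nonneg[OF nonneg(3)] of_int_scaled_instance(2)[of J]
    by (simp add: corrko_of_def)
  have "rat_of_nat (path_length (dst I) P) = of_int (scale_factor J) * path_length (kdst J) P"
    using assms by (intro of_nat_path_length of_nat_dst) auto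
  then have "path_length (dst I) P \<le> travel_budget I \<longleftrightarrow>
    of_int (scale_factor J) * path_length (kdst J) P \<le> of_int (scale_factor J) * kbudget J"
    by (metis b of_nat_le_iff)
  then show ?thesis using scale_factor_pos[of J] by simp
qed

lemma orientkd_feasible_iff:
  "orientkd_feasible J P \<longleftrightarrow> P \<noteq> [] \<and> hd P = kroot J \<and> distinct P \<and> set P \<subseteq> {..<knv J} \<and>
    path_length (dst I) P \<le> travel_budget I \<and>
    meets (\<lambda>v. scaled J (kweight J v)) (\<lambda>v. scaled J (kdeadline J v)) 0 P"
proof -
  have "meets (\<lambda>v. scaled J (kweight J v)) (\<lambda>v. scaled J (kdeadline J v)) 0 P \<longleftrightarrow>
    meets (kweight J) (kdeadline J) 0 P" if "set P \<subseteq> {..<knv J}"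
    using that scale_factor_pos[of J]
    by (intro meets_of_int[where c = "of_int (scale_factor J)"]) (auto simp: of_int_scaled_instance)
  then show ?thesis
    unfolding orientkd_feasible_def using path_length_dst[of P] by (auto simp: meets_iff)
qed

lemma feasible_tail:
  assumes "orientkd_feasible J P"
  obtains vs where "P = kroot J # vs" "distinct vs" "set vs \<subseteq> {..<knv J} - {kroot J}"
    "feasible_policy I (nonadaptive vs)"
    "\<And>us v ws. vs = us @ v # ws \<Longrightarrow>
      (\<Sum>u\<leftarrow>us. int (small_size J u)) + int (small_size J v) \<le> slack J v"
proof -
  note P = assms[unfolded orientkd_feasible_iff]
  obtain vs where vs: "P = kroot J # vs" using P by (cases P) auto
  have d: "distinct vs" "set vs \<subseteq> {..<knv J} - {kroot J}" using P vs by auto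
  have "feasible_policy I (nonadaptive vs)"
    unfolding feasible_policy_def Let_def
  proof (intro ballI)
    fix \<omega>
    obtain j where j: "run I (nonadaptive vs) \<omega> = map (\<lambda>v. (v, \<omega> v)) (take j vs)"
      using history_after_nonadaptive[of "knv J" vs \<omega>] by (auto simp: run_eq_history_after)
    have "visited I (run I (nonadaptive vs) \<omega>) = take (Suc j) P"
      by (simp add: visited_def j vs comp_def)
    moreover have "distinct (take (Suc j) P)" "set (take (Suc j) P) \<subseteq> {..<nv I}"
      using P set_take_subset[of "Suc j" P] by (auto simp del: take_Suc)
    moreover have "path_length (dst I) (take (Suc j) P) \<le> travel_budget I"
      using path_length_take_le P order_trans by blast
    ultimately show "distinct (visited I (run I (nonadaptive vs) \<omega>)) \<and>
      set (visited I (run I (nonadaptive vs) \<omega>)) \<subseteq> {..<nv I} \<and>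
      path_length (dst I) (visited I (run I (nonadaptive vs) \<omega>)) \<le> travel_budget I"
      by simp
  qed
  moreover have "(\<Sum>u\<leftarrow>us. int (small_size J u)) + int (small_size J v) \<le> slack J v"
    if "vs = us @ v # ws" for us v ws
  proof -
    have "int (small_size J u) = scaled J (kweight J u)" if "u \<in> set us" for u
      using d that \<open>vs = us @ v # ws\<close> by (intro int_small_size) auto
    then have "(\<Sum>u\<leftarrow>us. int (small_size J u)) = (\<Sum>u\<leftarrow>us. scaled J (kweight J u))"
      by (intro arg_cong[where f = sum_list] map_cong) auto
    moreover have "int (small_size J v) = scaled J (kweight J v)"
      using d that by (intro int_small_size) auto
    moreover have "(\<Sum>u\<leftarrow>us @ [v]. small_size J u) \<le> total_size J"
      using d that by (intro sum_small_size_le) auto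
    then have "(\<Sum>u\<leftarrow>us. int (small_size J u)) + int (small_size J v) \<le> int (total_size J)"
      by (simp flip: of_nat_sum_list)
    ultimately show ?thesis
      using P by (auto simp: vs that meets_append slack_def)
  qed
  ultimately show ?thesis using that[OF vs d] by blast
qed

lemma output_feasible:
  assumes feas: "feasible_policy I pol" and "orientkd_feasible J P"
  shows "orientkd_feasible J (kroot J # timely_run pol)"
proof -
  define h where "h = run I pol (small J)"
  interpret Metric_space "{..<knv J}" "\<lambda>u v. real_of_rat (kdst J u v)" by (rule metric)
  have run: "distinct (visited I h)" "set (visited I h) \<subseteq> {..<knv J}"
    "path_length (dst I) (visited I h) \<le> travel_budget I"
    using feas small_outcome unfolding feasible_policy_def Let_def h_def by auto
  have tri: "kdst J u w \<le> kdst J u v + kdst J v w"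
    if "u \<in> {..<knv J}" "v \<in> {..<knv J}" "w \<in> {..<knv J}" for u v w
    using triangle[OF that] by (simp add: of_rat_less_eq flip: of_rat_add)
  have "path_length (kdst J) (kroot J # timely_run pol) \<le> path_length (kdst J) (kroot J # map fst h)"
    using run(2) kdst_nonneg tri unfolding timely_run_def h_def visited_def
    by (intro path_length_subseq_le[where V = "{..<knv J}"] subseq_timely) auto
  also have "\<dots> \<le> kbudget J"
    using run(2,3) path_length_dst[of "visited I h"] by (simp add: visited_def)
  finally have "path_length (dst I) (kroot J # timely_run pol) \<le> travel_budget I"
    using timely_run_subset[OF feas] root_less by (subst path_length_dst) auto
  moreover have "meets (\<lambda>v. scaled J (kweight J v)) (\<lambda>v. scaled J (kdeadline J v)) 0 (kroot J # timely_run pol)"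
  proof -
    have "int (fst x) = scaled J (kweight J v)" if "(v, x) \<in> set h" for v x
    proof -
      have "x = small J v" using that history_after_values unfolding h_def run_eq_history_after by blast
      moreover define Q where "Q = map fst h"
      have "v \<in> set Q" using that by (force simp: Q_def)
      then have "v < knv J" "v \<noteq> kroot J" using run(1,2) unfolding visited_def Q_def[symmetric] by auto
      ultimately show ?thesis by (simp add: small_def int_small_size)
    qed
    then have "meets (\<lambda>v. scaled J (kweight J v)) (\<lambda>v. scaled J (kdeadline J v))
        (scaled J (kweight J (kroot J))) (timely_run pol)"
      unfolding timely_run_def h_def by (intro meets_timely) auto
    moreover have "scaled J (kweight J (kroot J)) \<le> scaled J (kdeadline J (kroot J))"
      using assms(2) unfolding orientkd_feasible_iff by (cases P) auto
    ultimately show ?thesis by simp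
  qed
  ultimately show ?thesis
    using timely_run_subset[OF feas] root_less unfolding orientkd_feasible_iff by auto
qed

lemma output_value:
  assumes feas: "feasible_policy I pol" and P: "orientkd_feasible J P" and "1 \<le> a"
    and approx: "\<And>vs. feasible_policy I (nonadaptive vs) \<Longrightarrow>
      1 / a * expected_reward I (nonadaptive vs) \<le> expected_reward I pol"
  shows "1 / (2 * a) * real_of_rat (orientkd_value J P)
    \<le> real_of_rat (orientkd_value J (kroot J # timely_run pol))"
proof -
  obtain vs where vs: "P = kroot J # vs" "distinct vs" "set vs \<subseteq> {..<knv J} - {kroot J}"
    "feasible_policy I (nonadaptive vs)"
    "\<And>us v ws. vs = us @ v # ws \<Longrightarrow>
      (\<Sum>u\<leftarrow>us. int (small_size J u)) + int (small_size J v) \<le> slack J v"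
    using feasible_tail[OF P] by blast
  define n where "n = real (knv J)"
  define f where "f = real_of_int (scale_factor J)"
  define opt where "opt = real_of_rat (\<Sum>v\<in>set vs. kreward J v)"
  define out where "out = real_of_rat (\<Sum>v\<in>set (timely_run pol). kreward J v)"
  define r where "r = real_of_rat (kreward J (kroot J))"
  have pos: "0 < n" "0 < f" "0 \<le> r"
    using root_less scale_factor_pos[of J] nonneg(1) by (simp_all add: n_def f_def r_def)
  have scale: "real_of_rat (\<Sum>v\<in>A. large_reward J v) = f * real_of_rat (\<Sum>v\<in>A. kreward J v)"
    if "A \<subseteq> {..<knv J} - {kroot J}" for A
  proof -
    have "(\<Sum>v\<in>A. large_reward J v) = of_int (scale_factor J) * (\<Sum>v\<in>A. kreward J v)"
      using that unfolding sum_distrib_left by (intro sum.cong) (auto simp: large_reward_eq)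
    then show ?thesis by (simp add: of_rat_mult f_def)
  qed
  have "f * opt / (4 * n) \<le> expected_reward I (nonadaptive vs)"
    using expected_reward_nonadaptive_ge[OF vs(2,3,5)] by (simp add: scale[OF vs(3)] opt_def n_def)
  then have "1 / a * (f * opt / (4 * n)) \<le> 1 / a * expected_reward I (nonadaptive vs)"
    using assms(3) by (intro mult_left_mono) auto
  also have "\<dots> \<le> expected_reward I pol" by (rule approx[OF vs(4)])
  also have "\<dots> \<le> f * out / (2 * n)"
    using expected_reward_le[OF feas] by (simp add: scale[OF timely_run_subset(1)[OF feas]] out_def n_def)
  finally have "f / (2 * n) * (1 / (2 * a) * opt) \<le> f / (2 * n) * out"
    by (simp add: mult_ac)
  then have "1 / (2 * a) * opt \<le> out"
    using pos by (subst (asm) mult_le_cancel_left_pos) auto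
  moreover have "1 / (2 * a) * r \<le> r"
    using assms(3) pos by (intro mult_left_le_one_le) auto
  moreover have "real_of_rat (orientkd_value J P) = r + opt"
    using vs(3) by (simp add: orientkd_value_def vs(1) r_def opt_def of_rat_add insert_Diff_if)
      (subst sum.insert; auto simp: of_rat_add)
  moreover have "real_of_rat (orientkd_value J (kroot J # timely_run pol)) = r + out"
    using timely_run_subset(1)[OF feas] by (simp add: orientkd_value_def r_def out_def of_rat_add insert_Diff_if)
      (subst sum.insert; auto simp: of_rat_add)
  ultimately show ?thesis by (simp add: distrib_left)
qed

end

section \<open>The reduction runs in polynomial time\<close>

abbreviation kd_instances :: "orientkd set" where
  "kd_instances \<equiv> {J. orientkd_instance J}"

lemma poly_time_enc: "poly_time e a D f \<Longrightarrow> poly_time e id D (\<lambda>x. a (f x))"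
  by (erule poly_time_cong) simp

lemma poly_time_orientkd_fields:
  shows poly_time_knv: "poly_time enc_orientkd enc_nat D knv"
    and poly_time_kroot: "poly_time enc_orientkd enc_nat D kroot"
    and poly_time_kdst_matrix: "poly_time enc_orientkd (enc_list (enc_list enc_rat)) D
      (\<lambda>J. map (\<lambda>u. map (kdst J u) [0..<knv J]) [0..<knv J])"
    and poly_time_kbudget: "poly_time enc_orientkd enc_rat D kbudget"
    and poly_time_kreward_list: "poly_time enc_orientkd (enc_list enc_rat) D (\<lambda>J. map (kreward J) [0..<knv J])"
    and poly_time_kweight_list: "poly_time enc_orientkd (enc_list enc_rat) D (\<lambda>J. map (kweight J) [0..<knv J])"
    and poly_time_kdeadline_list: "poly_time enc_orientkd (enc_list enc_rat) D (\<lambda>J. map (kdeadline J) [0..<knv J])"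
proof -
  define fields where "fields J =
     [enc_nat (knv J), enc_nat (kroot J),
      enc_list (enc_list enc_rat) (map (\<lambda>u. map (kdst J u) [0..<knv J]) [0..<knv J]),
      enc_rat (kbudget J),
      enc_list enc_rat (map (kreward J) [0..<knv J]),
      enc_list enc_rat (map (kweight J) [0..<knv J]),
      enc_list enc_rat (map (kdeadline J) [0..<knv J])]" for J :: orientkd
  have "poly_time enc_orientkd (enc_list id) D fields"
    by (rule poly_time_cong[OF poly_time_id]) (auto simp: fields_def enc_orientkd_def)
  then have *: "poly_time enc_orientkd id D (\<lambda>J. fields J ! i)" if "i < 7" for i
    using that by (intro poly_time_nth poly_time_const) (assumption, simp add: fields_def)
  show "poly_time enc_orientkd enc_nat D knv"
    by (rule poly_time_cong[OF *[of 0]]) (auto simp: fields_def)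
  show "poly_time enc_orientkd enc_nat D kroot"
    by (rule poly_time_cong[OF *[of 1]]) (auto simp: fields_def)
  show "poly_time enc_orientkd (enc_list (enc_list enc_rat)) D
      (\<lambda>J. map (\<lambda>u. map (kdst J u) [0..<knv J]) [0..<knv J])"
    by (rule poly_time_cong[OF *[of 2]]) (auto simp: fields_def)
  show "poly_time enc_orientkd enc_rat D kbudget"
    by (rule poly_time_cong[OF *[of 3]]) (auto simp: fields_def)
  show "poly_time enc_orientkd (enc_list enc_rat) D (\<lambda>J. map (kreward J) [0..<knv J])"
    by (rule poly_time_cong[OF *[of 4]]) (auto simp: fields_def)
  show "poly_time enc_orientkd (enc_list enc_rat) D (\<lambda>J. map (kweight J) [0..<knv J])"
    by (rule poly_time_cong[OF *[of 5]]) (auto simp: fields_def)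
  show "poly_time enc_orientkd (enc_list enc_rat) D (\<lambda>J. map (kdeadline J) [0..<knv J])"
    by (rule poly_time_cong[OF *[of 6]]) (auto simp: fields_def)
qed

lemma poly_time_upt_knv: "poly_time enc_orientkd (enc_list enc_nat) D (\<lambda>J. [0..<knv J])"
  using poly_time_upt_length[OF poly_time_kweight_list] by simp

lemma poly_time_vertex_data:
  assumes "poly_time enc_orientkd (enc_list enc_rat) UNIV (\<lambda>J. map (f J) [0..<knv J])"
    and "poly_time e enc_orientkd D j" "poly_time e enc_nat D v" "\<And>x. x \<in> D \<Longrightarrow> v x < knv (j x)"
  shows "poly_time e enc_rat D (\<lambda>x. f (j x) (v x))"
proof -
  have "poly_time e enc_rat D (\<lambda>x. map (f (j x)) [0..<knv (j x)] ! v x)"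
    using assms(3,4) by (intro poly_time_nth poly_time_comp[OF assms(1,2)]) auto
  then show ?thesis by (rule poly_time_cong) (simp add: assms(4))
qed

lemmas poly_time_kreward = poly_time_vertex_data[OF poly_time_kreward_list]
  and poly_time_kweight = poly_time_vertex_data[OF poly_time_kweight_list]
  and poly_time_kdeadline = poly_time_vertex_data[OF poly_time_kdeadline_list]

lemma poly_time_denominators_prod:
  assumes "poly_time e (enc_list enc_rat) D f"
  shows "poly_time e Num D (\<lambda>x. denominators_prod (f x))"
  unfolding denominators_prod_def
  by (rule poly_time_prod_list, rule poly_time_map[where E = UNIV, OF _ assms])
    (rule poly_time_den, rule poly_time_snd, rule poly_time_id, simp)

lemma poly_time_scale_factor: "poly_time enc_orientkd Num D scale_factor"
proof -
  have "poly_time enc_orientkd Num D (\<lambda>J. prod_list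
    (map denominators_prod (map (\<lambda>u. map (kdst J u) [0..<knv J]) [0..<knv J])))"
    by (rule poly_time_prod_list, rule poly_time_map[where E = UNIV, OF _ poly_time_kdst_matrix])
      (auto intro!: poly_time_denominators_prod poly_time_snd poly_time_id)
  then show ?thesis
    unfolding scale_factor_def map_map comp_def
    by (intro poly_time_mult poly_time_denominators_prod poly_time_den poly_time_kbudget
        poly_time_kreward_list poly_time_kweight_list poly_time_kdeadline_list)
qed

lemma poly_time_scaled:
  assumes "poly_time e enc_orientkd D j" "poly_time e enc_rat D q"
  shows "poly_time e Num D (\<lambda>x. scaled (j x) (q x))"
  unfolding scaled_def
  by (intro poly_time_mult poly_time_div poly_time_num poly_time_den assms
      poly_time_comp[OF poly_time_scale_factor[of UNIV] assms(1)]) auto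

lemma kd_instances_nonneg:
  assumes "J \<in> kd_instances"
  shows "v < knv J \<Longrightarrow> 0 \<le> kreward J v" "v < knv J \<Longrightarrow> 0 \<le> kweight J v" "0 \<le> kbudget J"
    "0 \<le> kdst J u v" "kroot J < knv J"
proof -
  interpret reduction J using assms by unfold_locales simp
  show "v < knv J \<Longrightarrow> 0 \<le> kreward J v" "v < knv J \<Longrightarrow> 0 \<le> kweight J v" "0 \<le> kbudget J"
    "0 \<le> kdst J u v" "kroot J < knv J"
    using nonneg kdst_nonneg root_less by auto
qed

lemma poly_time_small_size:
  assumes "poly_time e enc_orientkd D j" "poly_time e enc_nat D v"
    "\<And>x. x \<in> D \<Longrightarrow> j x \<in> kd_instances \<and> v x < knv (j x)"
  shows "poly_time e enc_nat D (\<lambda>x. small_size (j x) (v x))"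
proof -
  have "poly_time e enc_nat D (\<lambda>x. if v x = kroot (j x) then 0 else nat (scaled (j x) (kweight (j x) (v x))))"
    using assms
    by (intro poly_time_if poly_time_eq_nat poly_time_const poly_time_nat poly_time_scaled poly_time_kweight
        poly_time_comp[OF poly_time_kroot[of UNIV] assms(1)])
      (auto intro: poly_time_subset scaled_nonneg kd_instances_nonneg)
  then show ?thesis
    by (rule poly_time_cong) (use assms(3) in \<open>auto simp: small_size_def\<close>)
qed

lemma poly_time_total_size: "poly_time enc_orientkd enc_nat kd_instances total_size"
proof -
  have "poly_time enc_orientkd Num kd_instances (\<lambda>J. sum_list (map (\<lambda>v. int (small_size J v)) [0..<knv J]))"
    by (rule poly_time_sum_list,
        rule poly_time_map[where E = "{(J, v). J \<in> kd_instances \<and> v < knv J}", OF _ poly_time_upt_knv],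
        intro poly_time_int poly_time_small_size poly_time_fst poly_time_snd; (rule poly_time_id)?) auto
  then show ?thesis
    by (rule poly_time_cong)
      (simp add: total_size_def enc_nat_def interv_sum_list_conv_sum_set_nat atLeast0LessThan)
qed

lemma poly_time_Fract:
  assumes "poly_time e Num D a" "poly_time e Num D b" "\<And>x. x \<in> D \<Longrightarrow> 0 < b x \<and> coprime (a x) (b x)"
  shows "poly_time e enc_rat D (\<lambda>x. Fract (a x) (b x))"
  by (rule poly_time_cong[OF poly_time_pair[OF assms(1,2)]])
    (use assms(3) in \<open>auto simp: enc_rat_def quotient_of_Fract\<close>)

lemma poly_time_of_int:
  assumes "poly_time e Num D i" shows "poly_time e enc_rat D (\<lambda>x. of_int (i x))"
  using poly_time_Fract[OF assms poly_time_const[of _ _ _ 1]] by (simp add: Fract_of_int_eq)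

definition enc_job :: "nat \<times> rat \<Rightarrow> val" where
  "enc_job = enc_pair enc_nat enc_rat"

lemma poly_time_small:
  assumes "poly_time e enc_orientkd D j" "poly_time e enc_nat D v"
    "\<And>x. x \<in> D \<Longrightarrow> j x \<in> kd_instances \<and> v x < knv (j x)"
  shows "poly_time e enc_job D (\<lambda>x. small (j x) (v x))"
  unfolding small_def enc_job_def
  by (intro poly_time_pair poly_time_small_size assms poly_time_const)

lemma poly_time_large:
  assumes j: "poly_time e enc_orientkd D j" and v: "poly_time e enc_nat D v"
    and D: "\<And>x. x \<in> D \<Longrightarrow> j x \<in> kd_instances \<and> v x < knv (j x)"
  shows "poly_time e enc_job D (\<lambda>x. large (j x) (v x))"
proof -
  have total: "poly_time e Num D (\<lambda>x. int (total_size (j x)))"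
    using D by (intro poly_time_int poly_time_comp[OF poly_time_total_size j]) auto
  have root: "poly_time e enc_nat D (\<lambda>x. kroot (j x))"
    by (intro poly_time_comp[OF poly_time_kroot[of UNIV] j]) auto
  show ?thesis
    unfolding large_def enc_job_def large_size_def large_reward_def slack_def of_nat_add of_nat_mult
    using D kd_instances_nonneg(5)
    by (intro poly_time_pair poly_time_nat poly_time_add poly_time_diff poly_time_min poly_time_mult
        poly_time_const poly_time_scaled poly_time_kweight poly_time_kreward poly_time_kdeadline
        poly_time_of_int poly_time_int poly_time_small_size total root j v) auto
qed

lemma enc_corrko_job_entry:
  "(\<lambda>((s, r), q). Node (Node (enc_nat s) (enc_rat r)) (enc_rat q)) = enc_pair enc_job enc_rat"
  by (auto simp: enc_job_def enc_pair_def)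

lemma poly_time_jobs:
  assumes j: "poly_time e enc_orientkd D j" and v: "poly_time e enc_nat D v"
    and D: "\<And>x. x \<in> D \<Longrightarrow> j x \<in> kd_instances \<and> v x < knv (j x)"
  shows "poly_time e (enc_list (enc_pair enc_job enc_rat)) D (\<lambda>x. jobs (corrko_of (j x)) (v x))"
proof -
  have root: "poly_time e enc_nat D (\<lambda>x. kroot (j x))"
    by (intro poly_time_comp[OF poly_time_kroot[of UNIV] j]) auto
  have n: "poly_time e Num D (\<lambda>x. 2 * int (knv (j x)))"
    by (intro poly_time_mult poly_time_const poly_time_int poly_time_comp[OF poly_time_knv[of UNIV] j]) auto
  have pos: "0 < knv (j x)" if "x \<in> D" for x using D[OF that] by auto
  have cop: "coprime (2 * int n - 1) (2 * int n)" for n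
    by (metis coprime_diff_one_left)
  have "poly_time e (enc_list (enc_pair enc_job enc_rat)) D
    (\<lambda>x. [(small (j x) (v x), Fract (2 * int (knv (j x)) - 1) (2 * int (knv (j x)))),
          (large (j x) (v x), Fract 1 (2 * int (knv (j x))))])"
    using D pos cop
    by (intro poly_time_Cons poly_time_Nil poly_time_pair poly_time_small poly_time_large poly_time_Fract
        poly_time_diff n poly_time_const j v) auto
  then show ?thesis
    unfolding corrko_of_def corrko.simps
    by (intro poly_time_if poly_time_eq_nat root v poly_time_const) (erule poly_time_subset, auto)
qed

lemma poly_time_corrko_of: "poly_time enc_orientkd enc_corrko kd_instances corrko_of"
proof -
  define matrix where "matrix J = map (\<lambda>u. map (kdst J u) [0..<knv J]) [0..<knv J]" for J :: orientkd
  have inner: "poly_time (enc_pair enc_orientkd (enc_list enc_rat)) (enc_list enc_nat)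
    {(J, row). \<forall>q\<in>set row. 0 \<le> q} (\<lambda>p. map (\<lambda>q. nat (scaled (fst p) q)) (snd p))"
    by (rule poly_time_map[where E = "{(p, q). 0 \<le> q}"],
        intro poly_time_nat poly_time_scaled poly_time_fst poly_time_snd; (rule poly_time_id)?)
      (auto intro: scaled_nonneg poly_time_snd poly_time_id)
  have "poly_time enc_orientkd (enc_list (enc_list enc_nat)) kd_instances
    (\<lambda>J. map (map (\<lambda>q. nat (scaled J q))) (matrix J))"
    unfolding matrix_def
    by (rule poly_time_map[OF inner poly_time_kdst_matrix]) (auto simp: kd_instances_nonneg(4))
  then have dst: "poly_time enc_orientkd (enc_list (enc_list enc_nat)) kd_instances
    (\<lambda>J. map (\<lambda>u. map (dst (corrko_of J) u) [0..<knv J]) [0..<knv J])"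
    by (rule poly_time_cong) (simp add: matrix_def corrko_of_def comp_def)
  have budget: "poly_time enc_orientkd enc_nat kd_instances (\<lambda>J. travel_budget (corrko_of J))"
    unfolding corrko_of_def corrko.simps
    by (intro poly_time_nat poly_time_scaled poly_time_id poly_time_kbudget)
      (auto intro: scaled_nonneg kd_instances_nonneg)
  have "poly_time enc_orientkd enc_nat kd_instances (\<lambda>J. nat (2 * int (total_size J) + 1))"
    by (intro poly_time_nat poly_time_add poly_time_mult poly_time_const poly_time_int poly_time_total_size) auto
  then have proc: "poly_time enc_orientkd enc_nat kd_instances (\<lambda>J. 2 * total_size J + 1)"
    by (rule poly_time_cong) (auto simp: enc_nat_def)
  have jobs: "poly_time enc_orientkd (enc_list (enc_list (enc_pair enc_job enc_rat))) kd_instances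
    (\<lambda>J. map (jobs (corrko_of J)) [0..<knv J])"
    by (rule poly_time_map[where E = "{(J, v). J \<in> kd_instances \<and> v < knv J}", OF _ poly_time_upt_knv],
        intro poly_time_jobs poly_time_fst poly_time_snd; (rule poly_time_id)?) auto
  show ?thesis
    by (rule poly_time_cong[OF poly_time_Cons[OF poly_time_enc[OF poly_time_knv]
            poly_time_Cons[OF poly_time_enc[OF poly_time_kroot]
            poly_time_Cons[OF poly_time_enc[OF dst]
            poly_time_Cons[OF poly_time_enc[OF budget]
            poly_time_Cons[OF poly_time_enc[OF proc]
            poly_time_Cons[OF poly_time_enc[OF jobs] poly_time_Nil]]]]]]])
      (simp add: enc_corrko_def enc_corrko_job_entry)
qed

section \<open>Simulating the policy\<close>

definition enc_entry :: "nat \<times> nat \<times> rat \<Rightarrow> val" where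
  "enc_entry = enc_pair enc_nat enc_job"

lemma enc_history_eq: "enc_history = enc_list enc_entry"
  unfolding enc_history_def enc_entry_def enc_job_def enc_pair_def
  by (intro arg_cong[where f = enc_list] ext) auto

lemma poly_time_used:
  assumes "poly_time e enc_history D h"
  shows "poly_time e enc_nat D (\<lambda>x. used (h x))"
proof -
  have entry: "poly_time (enc_pair e enc_entry) (enc_pair enc_nat (enc_pair enc_nat enc_rat)) UNIV snd"
    unfolding enc_entry_def enc_job_def by (rule poly_time_snd[OF poly_time_id])
  have "poly_time e Num D (\<lambda>x. sum_list (map (\<lambda>y. int (fst (snd y))) (h x)))"
    by (rule poly_time_sum_list, rule poly_time_map[where E = UNIV, OF _ assms[unfolded enc_history_eq]],
        rule poly_time_int[OF poly_time_fst[OF poly_time_snd[OF entry]]]) simp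
  then show ?thesis
    by (rule poly_time_cong) (simp add: enc_nat_def used_def of_nat_sum_list case_prod_beta)
qed

lemma vsize_enc_list_distinct_le:
  assumes "distinct xs" "set xs \<subseteq> set ys"
  shows "vsize (enc_list e xs) \<le> vsize (enc_list e ys)"
proof -
  have "(\<Sum>x\<leftarrow>xs. 1 + vsize (e x)) = (\<Sum>x\<in>set xs. 1 + vsize (e x))"
    using assms(1) by (simp add: sum_list_distinct_conv_sum_set)
  also have "\<dots> \<le> (\<Sum>x\<in>set (remdups ys). 1 + vsize (e x))"
    using assms(2) by (intro sum_mono2) auto
  also have "\<dots> = (\<Sum>x\<leftarrow>remdups ys. 1 + vsize (e x))"
    by (rule sum_list_distinct_conv_sum_set[symmetric]) simp
  also have "\<dots> \<le> (\<Sum>x\<leftarrow>ys. 1 + vsize (e x))"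
    by (induction ys) auto
  finally show ?thesis by (simp only: vsize_enc_list add_le_cancel_left)
qed

lemma foldl_funpow: "foldl (\<lambda>s _. f s) s xs = (f ^^ length xs) s"
  by (induction xs arbitrary: s) (auto simp: funpow_swap1)

lemma (in reduction) small_run_history:
  assumes "feasible_policy I pol" "k \<le> knv J"
  shows "history_after I pol (small J) k \<in> histories I"
    and "set (history_after I pol (small J) k) \<subseteq> (\<lambda>v. (v, small J v)) ` {..<knv J}"
proof -
  define h where "h = history_after I pol (small J) k"
  define P where "P = map fst h"
  have visited: "distinct (kroot J # P)" "set (kroot J # P) \<subseteq> {..<knv J}"
    using visited_feasible[OF assms(1) small_outcome, of k] assms(2)
    by (simp_all add: visited_def P_def h_def)
  have *: "v < knv J \<and> x = small J v \<and> x \<in> set_pmf (job_pmf I v)" if "(v, x) \<in> set h" for v x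
  proof -
    have "v \<in> set P" using that by (force simp: P_def)
    then have "v < knv J" using visited by auto
    moreover have "x = small J v" using history_after_values that unfolding h_def by blast
    moreover have "small J v \<in> set_pmf (job_pmf I v)"
      using small_outcome \<open>v < knv J\<close> by (auto simp: outcomes_def set_Pi_pmf PiE_dflt_def)
    ultimately show ?thesis by simp
  qed
  then show "set (history_after I pol (small J) k) \<subseteq> (\<lambda>v. (v, small J v)) ` {..<knv J}"
    unfolding h_def by fast
  show "history_after I pol (small J) k \<in> histories I"
  proof -
    have "distinct (visited I h)" using visited(1) by (simp add: visited_def P_def)
    then show ?thesis using * unfolding histories_def h_def[symmetric] by auto
  qed
qed

lemma poly_time_small_run:
  assumes A: "poly_time enc_corrko id {I. corrko_instance I} A"
    and Q: "poly_time (\<lambda>(z, h). Node z (enc_history h)) enc_option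
       {(A I, h) | I h. corrko_instance I \<and> h \<in> histories I} Q"
    and feas: "\<And>I. corrko_instance I \<Longrightarrow> feasible_policy I (\<lambda>h. Q (A I, h))"
  shows "poly_time enc_orientkd enc_history kd_instances
    (\<lambda>J. run (corrko_of J) (\<lambda>h. Q (A (corrko_of J), h)) (small J))"
proof -
  define pol where "pol J h = Q (A (corrko_of J), h)" for J h
  have inst: "reduction J" if "J \<in> kd_instances" for J
    using that by (simp add: reduction_def)
  have corrko: "corrko_instance (corrko_of J)" if "J \<in> kd_instances" for J
    using reduction.corrko_instance[OF inst[OF that]] .
  have pol_feas: "feasible_policy (corrko_of J) (pol J)" if "J \<in> kd_instances" for J
    using feas[OF corrko[OF that]] unfolding pol_def .
  have z: "poly_time enc_orientkd id kd_instances (\<lambda>J. A (corrko_of J))"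
    using corrko by (intro poly_time_comp[OF A poly_time_corrko_of]) auto
  have Q': "poly_time (enc_pair id enc_history) enc_option
       {(A I, h) | I h. corrko_instance I \<and> h \<in> histories I} (\<lambda>p. Q (fst p, snd p))"
    using Q by (simp add: enc_pair_def)
  define entries where "entries J = map (\<lambda>v. (v, small J v)) [0..<knv J]" for J
  have entries: "poly_time enc_orientkd enc_history kd_instances entries"
    unfolding entries_def enc_history_eq enc_entry_def
    by (rule poly_time_map[where E = "{(J, v). J \<in> kd_instances \<and> v < knv J}", OF _ poly_time_upt_knv],
        intro poly_time_pair poly_time_small poly_time_fst poly_time_snd; (rule poly_time_id)?) auto
  define E where "E = {(J, h, i :: nat). J \<in> kd_instances \<and> h \<in> histories (corrko_of J) \<and>
    (\<forall>v. used h \<le> 2 * total_size J + 1 \<longrightarrow> pol J h = Some v \<longrightarrow> v < knv J)}"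
  have "poly_time enc_orientkd enc_history kd_instances
    (\<lambda>J. foldl (\<lambda>h _. policy_step (corrko_of J) (pol J) (small J) h) [] [0..<knv J])"
  proof (rule poly_time_foldl[where E = E and B = "\<lambda>J. vsize (enc_history (entries J))",
        OF _ poly_time_const poly_time_upt_knv])
    show "poly_bounded enc_orientkd kd_instances (\<lambda>J. vsize (enc_history (entries J)))"
      by (rule poly_time_size[OF entries])
    have J: "poly_time (enc_pair enc_orientkd (enc_pair enc_history enc_nat)) enc_orientkd X fst"
      and h: "poly_time (enc_pair enc_orientkd (enc_pair enc_history enc_nat)) enc_history X (\<lambda>p. fst (snd p))" for X
      by (intro poly_time_fst poly_time_snd; rule poly_time_id)+
    have proc: "poly_time (enc_pair enc_orientkd (enc_pair enc_history enc_nat)) enc_nat E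
        (\<lambda>p. nat (2 * int (total_size (fst p)) + 1))"
      by (intro poly_time_nat poly_time_add poly_time_mult poly_time_const poly_time_int
          poly_time_comp[OF poly_time_total_size J]) (auto simp: E_def)
    have query: "poly_time (enc_pair enc_orientkd (enc_pair enc_history enc_nat)) enc_option E
        (\<lambda>p. pol (fst p) (fst (snd p)))"
      unfolding pol_def
      by (rule poly_time_comp2[OF Q' poly_time_comp[OF z J] h]) (use corrko in \<open>auto simp: E_def\<close>)
    have used: "poly_time (enc_pair enc_orientkd (enc_pair enc_history enc_nat)) enc_bool E
        (\<lambda>p. used (fst (snd p)) \<le> nat (2 * int (total_size (fst p)) + 1))"
      by (intro poly_time_le_nat poly_time_used h proc)
    have append: "poly_time (enc_pair (enc_pair enc_orientkd (enc_pair enc_history enc_nat)) enc_nat) enc_history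
        {(p, v). p \<in> {p \<in> E. used (fst (snd p)) \<le> nat (2 * int (total_size (fst p)) + 1)} \<and> pol (fst p) (fst (snd p)) = Some v}
        (\<lambda>q. fst (snd (fst q)) @ [(snd q, small (fst (fst q)) (snd q))])"
      unfolding enc_history_eq enc_entry_def
      by (intro poly_time_snoc poly_time_pair poly_time_small poly_time_fst poly_time_snd; (rule poly_time_id)?)
        (auto simp: E_def)
    show "poly_time (enc_pair enc_orientkd (enc_pair enc_history enc_nat)) enc_history E
      (\<lambda>p. policy_step (corrko_of (fst p)) (pol (fst p)) (small (fst p)) (fst (snd p)))"
    proof (rule poly_time_cong[OF poly_time_if[OF used poly_time_option[OF poly_time_subset[OF query] h append] h]])
      show "x \<in> E \<and> enc_history (policy_step (corrko_of (fst x)) (pol (fst x)) (small (fst x)) (fst (snd x))) =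
        enc_history (if used (fst (snd x)) \<le> nat (2 * int (total_size (fst x)) + 1)
          then case pol (fst x) (fst (snd x)) of None \<Rightarrow> fst (snd x)
            | Some v \<Rightarrow> fst (snd x) @ [(v, small (fst x) v)]
          else fst (snd x))" if "x \<in> E" for x
        using that by (auto simp: policy_step_def nat_add_distrib nat_mult_distrib split: option.split)
    qed auto
    fix J and ys zs :: "nat list"
    assume J: "J \<in> kd_instances" and ys: "[0..<knv J] = ys @ zs"
    interpret reduction J by (rule inst[OF J])
    have "length ys \<le> length [0..<knv J]" unfolding ys by simp
    then have k: "length ys \<le> knv J" by simp
    have eq: "foldl (\<lambda>h _. policy_step (corrko_of J) (pol J) (small J) h) [] ys =
        history_after (corrko_of J) (pol J) (small J) (length ys)"
      unfolding foldl_funpow by (simp add: history_after_def)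
    have "distinct (visited I (history_after I (pol J) (small J) (length ys)))"
      using small_run_history(1)[OF pol_feas[OF J] k] by (simp add: histories_def)
    then have "distinct (history_after I (pol J) (small J) (length ys))"
      by (simp add: visited_def distinct_map)
    then show "vsize (enc_history (foldl (\<lambda>h _. policy_step (corrko_of J) (pol J) (small J) h) [] ys))
        \<le> vsize (enc_history (entries J))"
      unfolding eq enc_history_eq
      using small_run_history(2)[OF pol_feas[OF J] k]
      by (intro vsize_enc_list_distinct_le) (auto simp: entries_def)
  next
    fix J a and ys zs :: "nat list"
    assume J: "J \<in> kd_instances" and ys: "[0..<knv J] = ys @ a # zs"
    interpret reduction J by (rule inst[OF J])
    have "length ys < length [0..<knv J]" unfolding ys by simp
    then have k: "Suc (length ys) \<le> knv J" by simp
    define h where "h = history_after (corrko_of J) (pol J) (small J) (length ys)"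
    have eq: "foldl (\<lambda>h _. policy_step (corrko_of J) (pol J) (small J) h) [] ys = h"
      unfolding foldl_funpow by (simp add: h_def history_after_def)
    have "v < knv J" if "used h \<le> 2 * total_size J + 1" "pol J h = Some v" for v
    proof -
      have "history_after (corrko_of J) (pol J) (small J) (Suc (length ys)) = h @ [(v, small J v)]"
        using that by (simp add: history_after_Suc policy_step_def flip: h_def)
      then show ?thesis using small_run_history(2)[OF pol_feas[OF J] k] by auto
    qed
    then show "(J, foldl (\<lambda>h _. policy_step (corrko_of J) (pol J) (small J) h) [] ys, a) \<in> E"
      using small_run_history(1)[OF pol_feas[OF J], of "length ys"] k J
      unfolding eq E_def by (simp add: h_def)
  qed
  then show ?thesis
    unfolding foldl_funpow by (simp add: run_def pol_def[abs_def])
qed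

lemma poly_time_timely:
  assumes h: "poly_time enc_orientkd enc_history kd_instances h"
    and D: "\<And>J v x. J \<in> kd_instances \<Longrightarrow> (v, x) \<in> set (h J) \<Longrightarrow> v < knv J"
  shows "poly_time enc_orientkd (enc_list enc_nat) kd_instances
    (\<lambda>J. timely J (scaled J (kweight J (kroot J))) (h J))"
proof -
  define s where "s J = scaled J (kweight J (kroot J))" for J
  define g where "g J p y = (fst p + int (fst (snd y)),
    if fst p + int (fst (snd y)) \<le> scaled J (kdeadline J (fst y)) then fst y # snd p else snd p)"
    for J and p :: "int \<times> nat list" and y :: "nat \<times> nat \<times> rat"
  have fold: "foldl (g J) (t, l) ys = (t + int (used ys), rev (timely J t ys) @ l)" for J t l ys
    by (induction J t ys arbitrary: l rule: timely.induct) (auto simp: g_def)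
  have s: "poly_time enc_orientkd Num kd_instances s"
    unfolding s_def
    by (intro poly_time_scaled poly_time_id poly_time_kweight poly_time_kroot) (rule kd_instances_nonneg)
  define B where "B J = 1 + vsize (Num (s J)) + vsize (enc_nat (used (h J))) + vsize (enc_history (h J))" for J
  have timely_size: "vsize (enc_list enc_nat (timely J t ys)) \<le> vsize (enc_history ys)" for J t ys
    unfolding enc_history_eq
    by (induction J t ys rule: timely.induct) (auto simp: enc_entry_def simp del: vsize.simps(1))
  have "poly_time enc_orientkd (enc_pair Num (enc_list enc_nat)) kd_instances (\<lambda>J. foldl (g J) (s J, []) (h J))"
  proof (rule poly_time_foldl[where E = "{(J, p, y). J \<in> kd_instances \<and> fst y < knv J}" and B = B,
        OF _ poly_time_pair[OF s poly_time_Nil] h[unfolded enc_history_eq]])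
    let ?e = "enc_pair enc_orientkd (enc_pair (enc_pair Num (enc_list enc_nat)) enc_entry)"
    have J: "poly_time ?e enc_orientkd X fst"
      and t: "poly_time ?e Num X (\<lambda>p. fst (fst (snd p)))"
      and l: "poly_time ?e (enc_list enc_nat) X (\<lambda>p. snd (fst (snd p)))"
      and y: "poly_time ?e (enc_pair enc_nat enc_job) X (\<lambda>p. snd (snd p))" for X
      unfolding enc_entry_def by (intro poly_time_fst poly_time_snd; rule poly_time_id)+
    note v = poly_time_fst[OF y] and size = poly_time_int[OF poly_time_fst[OF poly_time_snd[OF y[unfolded enc_job_def]]]]
    show "poly_time ?e (enc_pair Num (enc_list enc_nat)) {(J, p, y). J \<in> kd_instances \<and> fst y < knv J}
      (\<lambda>p. g (fst p) (fst (snd p)) (snd (snd p)))"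
      unfolding g_def
      by (intro poly_time_pair poly_time_if poly_time_le poly_time_add poly_time_scaled poly_time_kdeadline
          poly_time_Cons J t l v size) auto
    show "poly_bounded enc_orientkd kd_instances B"
      unfolding B_def
      by (intro poly_bounded_intros poly_time_size[OF s] poly_time_size[OF h] poly_time_size[OF poly_time_used[OF h]])
    fix J ys zs assume ys: "h J = ys @ zs"
    have "vsize (Num (s J + int (used ys))) \<le> vsize (Num (s J)) + vsize (Num (int (used ys)))"
      using vsize_Num_add[of "s J" "int (used ys)"] by linarith
    moreover have "vsize (Num (int (used ys))) \<le> vsize (enc_nat (used (h J)))"
      unfolding enc_nat_def by (rule vsize_Num_mono) (simp add: ys used_append)
    moreover have "vsize (enc_history ys) \<le> vsize (enc_history (h J))"
      using vsize_enc_list_append[of enc_entry ys zs] one_le_vsize[of "enc_list enc_entry zs"]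
      unfolding ys enc_history_eq by linarith
    then have "vsize (enc_list enc_nat (rev (timely J (s J) ys))) \<le> vsize (enc_history (h J))"
      using timely_size[of J "s J" ys] unfolding vsize_enc_list_rev by linarith
    ultimately show "vsize (enc_pair Num (enc_list enc_nat) (foldl (g J) (s J, []) ys)) \<le> B J"
      unfolding fold B_def by (simp del: vsize.simps(1))
  next
    fix J y ys zs assume "J \<in> kd_instances" "h J = ys @ y # zs"
    then show "(J, foldl (g J) (s J, []) ys, y) \<in> {(J, p, y). J \<in> kd_instances \<and> fst y < knv J}"
      using D[of J "fst y" "snd y"] by auto
  qed
  from poly_time_rev[OF poly_time_snd[OF this]] show ?thesis
    unfolding fold by (simp add: s_def)
qed

theorem theorem5p8:
  shows "\<exists>C::real. C > 0 \<and>
    (\<forall>\<alpha> :: nat \<Rightarrow> real. (\<forall>n. \<alpha> n \<ge> 1) \<longrightarrow>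
      (\<exists>A Q. corrko_approx_nonadaptive \<alpha> A Q) \<longrightarrow>
      (\<exists>alg. orientkd_approx (\<lambda>n. C * \<alpha> n) alg))"
proof (rule exI[of _ 2], intro conjI allI impI)
  fix \<alpha> :: "nat \<Rightarrow> real"
  assume \<alpha>: "\<forall>n. \<alpha> n \<ge> 1" and "\<exists>A Q. corrko_approx_nonadaptive \<alpha> A Q"
  then obtain A Q where AQ: "corrko_approx_nonadaptive \<alpha> A Q" by blast
  have A: "poly_time enc_corrko id {I. corrko_instance I} A"
    and Q: "poly_time (\<lambda>(z, h). Node z (enc_history h)) enc_option
       {(A I, h) | I h. corrko_instance I \<and> h \<in> histories I} Q"
    and feas: "\<And>I. corrko_instance I \<Longrightarrow> feasible_policy I (\<lambda>h. Q (A I, h))"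
    and approx: "\<And>I vs. corrko_instance I \<Longrightarrow> feasible_policy I (nonadaptive vs) \<Longrightarrow>
      1 / \<alpha> (nv I) * expected_reward I (nonadaptive vs) \<le> expected_reward I (\<lambda>h. Q (A I, h))"
    using AQ unfolding corrko_approx_nonadaptive_def Let_def by blast+
  define pol where "pol J h = Q (A (corrko_of J), h)" for J h
  define h where "h J = run (corrko_of J) (pol J) (small J)" for J
  define alg where "alg J = kroot J # timely J (scaled J (kweight J (kroot J))) (h J)" for J
  have run: "poly_time enc_orientkd enc_history kd_instances h"
    unfolding h_def pol_def by (rule poly_time_small_run[OF A Q feas])
  have pol_feas: "feasible_policy (corrko_of J) (pol J)" if "reduction J" for J
    using feas[OF reduction.corrko_instance[OF that]] unfolding pol_def .
  have "poly_time enc_orientkd (enc_list enc_nat) kd_instances alg"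
    unfolding alg_def
  proof (intro poly_time_Cons poly_time_kroot poly_time_timely run)
    fix J v x assume J: "J \<in> kd_instances" and v: "(v, x) \<in> set (h J)"
    then interpret reduction J by unfold_locales simp
    show "v < knv J"
      using small_run_history(2)[OF pol_feas[OF reduction_axioms], of "knv J"] v
      by (auto simp: h_def run_eq_history_after)
  qed
  moreover have "orientkd_feasible J (alg J) \<and>
        (\<forall>P. orientkd_feasible J P \<longrightarrow>
           real_of_rat (orientkd_value J (alg J)) \<ge>
             1 / (2 * \<alpha> (knv J)) * real_of_rat (orientkd_value J P))"
    if "orientkd_instance J" "\<exists>P. orientkd_feasible J P" for J
  proof -
    interpret reduction J using that by unfold_locales
    have alg: "alg J = kroot J # timely_run (pol J)"
      by (simp add: alg_def timely_run_def h_def)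
    have "1 / \<alpha> (knv J) * expected_reward I (nonadaptive vs) \<le> expected_reward I (pol J)"
      if "feasible_policy I (nonadaptive vs)" for vs
      using approx[OF corrko_instance that] unfolding pol_def by simp
    then show ?thesis
      using that(2) output_feasible[OF pol_feas[OF reduction_axioms]]
        output_value[OF pol_feas[OF reduction_axioms] _ \<alpha>[rule_format]]
      unfolding alg by blast
  qed
  ultimately show "\<exists>alg. orientkd_approx (\<lambda>n. 2 * \<alpha> n) alg"
    unfolding orientkd_approx_def by blast
qed simp

end
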